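(* Let $\mathcal{S}\subsetneq\mathcal{H}_d$ be a proper subspace. If $\mathcal{S}$ has an orthonormal basis $\{|\psi_i\rangle\}_{i=0}^{n-1}$ in which every $|\psi_i\rangle$ is a stabilizer state, then $\mathcal{S}$ is PWF extendible.
   Context: $\mathcal{H}_d$ is a Hilbert space of odd dimension $d\ge 3$; if $d$ is not prime, $\mathcal{H}_d$ is understood as a given tensor product of Hilbert spaces each of odd prime dimension. Phase-space operators. For $d$ an odd prime with computational basis $\{|j\rangle\}_{j\in\mathbb{Z}_d}$, let $X|j\rangle=|j+1 \bmod d\rangle$, $Z|j\rangle=e^{2\pi i j/d}|j\rangle$. For $\mathbf{u}=(a_1,a_2)\in\mathbb{Z}_d\times\mathbb{Z}_d$ let $T_{\mathbf{u}}=e^{-(d+1)\pi i a_1a_2/d}Z^{a_1}X^{a_2}$, $A_{\mathbf{0}}=\frac1d\sum_{\mathbf{u}}T_{\mathbf{u}}$, $A_{\mathbf{u}}=T_{\mathbf{u}}A_{\mathbf{0}}T_{\mathbf{u}}^\dagger$. For a tensor product of odd-prime-dimensional systems, the phase space is the product of the individual phase spaces, and $T_{\mathbf{u}}$ and $A_{\mathbf{u}}$ are the tensor products of the corresponding single-system operators. Wigner functions. A state $\rho$ on $\mathcal{H}_d$ has discrete Wigner function $W_\rho(\mathbf{u})=\frac1d\operatorname{Tr}[A_{\mathbf{u}}\rho]$; $\rho$ is a PWF state if $W_\rho(\mathbf{u})\ge 0$ for all $\mathbf{u}$. Stabilizer states. A unit vector $|\psi\rangle$ is a (pure) stabilizer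 state if $|\psi\rangle\langle\psi|=\frac{1}{|G|}\sum_{g\in G} g$ for some finite abelian group $G$ of unitaries, each a unit-modulus scalar multiple of some $T_{\mathbf{u}}$, containing no scalar operator other than the identity (so $|G|=d$). Extendibility. A subspace $\mathcal{S}\subseteq\mathcal{H}_d$ is PWF extendible if there is a PWF state on $\mathcal{H}_d$ whose support is contained in $\mathcal{S}^\perp$. *)

theory Defs
  imports
    "HOL-Algebra.Group"
    "HOL-Computational_Algebra.Primes"
    "Jordan_Normal_Form.Matrix_Kernel"
    "Jordan_Normal_Form.Schur_Decomposition"
begin

text \<open>
  A system is given by the list \<open>ps\<close> of the (odd prime) dimensions of its tensor factors.
  Its Hilbert space is \<open>carrier_vec (prod_list ps)\<close>, the product basis being enumerated with
  the first factor most significant. The inner product is \<open>v \<bullet>c w\<close>, which is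
  conjugate-linear in the second argument, and \<open>0 \<le> z\<close> for complex \<open>z\<close> means that \<open>z\<close> is real and
  nonnegative.
\<close>

abbreviation hdim :: "nat list \<Rightarrow> nat" where
  "hdim ps \<equiv> prod_list ps"


subsection \<open>Operators\<close>

definition trace :: "complex mat \<Rightarrow> complex" where
  "trace A = (\<Sum>i<dim_row A. A $$ (i, i))"

definition unitary :: "nat \<Rightarrow> complex mat \<Rightarrow> bool" where
  "unitary d A \<longleftrightarrow> A \<in> carrier_mat d d \<and> mat_adjoint A * A = 1\<^sub>m d \<and> A * mat_adjoint A = 1\<^sub>m d"

text \<open>Only the multiplicative structure of the matrix ring is used.\<close>

definition unitary_group :: "nat \<Rightarrow> complex mat ring" where
  "unitary_group d = (ring_mat TYPE(complex) d ())\<lparr>carrier := {A. unitary d A}\<rparr>"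

definition ketbra :: "complex vec \<Rightarrow> complex mat" where
  "ketbra \<psi> = mat (dim_vec \<psi>) (dim_vec \<psi>) (\<lambda>(i, j). \<psi> $ i * cnj (\<psi> $ j))"

definition mat_sum :: "nat \<Rightarrow> ('a \<Rightarrow> complex mat) \<Rightarrow> 'a set \<Rightarrow> complex mat" where
  "mat_sum d f I = finsum (module_mat TYPE(complex) d d) f I"

definition kron :: "complex mat \<Rightarrow> complex mat \<Rightarrow> complex mat" where
  "kron A B = mat (dim_row A * dim_row B) (dim_col A * dim_col B)
     (\<lambda>(i, j). A $$ (i div dim_row B, j div dim_col B) * B $$ (i mod dim_row B, j mod dim_col B))"

definition kron_list :: "complex mat list \<Rightarrow> complex mat" where
  "kron_list As = foldr kron As (1\<^sub>m 1)"


subsection \<open>Phase space\<close>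

definition shift_op :: "nat \<Rightarrow> complex mat" where
  "shift_op p = mat p p (\<lambda>(i, j). if i = (j + 1) mod p then 1 else 0)"

definition clock_op :: "nat \<Rightarrow> complex mat" where
  "clock_op p = mat p p (\<lambda>(i, j). if i = j then exp (2 * of_real pi * \<i> * of_nat j / of_nat p) else 0)"

fun displacement1 :: "nat \<Rightarrow> nat \<times> nat \<Rightarrow> complex mat" where
  "displacement1 p (a1, a2) =
     exp (- (of_nat (p + 1) * of_real pi * \<i> * of_nat a1 * of_nat a2 / of_nat p))
       \<cdot>\<^sub>m (clock_op p ^\<^sub>m a1 * shift_op p ^\<^sub>m a2)"

definition phase_space1 :: "nat \<Rightarrow> (nat \<times> nat) set" where
  "phase_space1 p = {..<p} \<times> {..<p}"

definition phase_point1_origin :: "nat \<Rightarrow> complex mat" where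
  "phase_point1_origin p = (1 / of_nat p) \<cdot>\<^sub>m mat_sum p (displacement1 p) (phase_space1 p)"

definition phase_point1 :: "nat \<Rightarrow> nat \<times> nat \<Rightarrow> complex mat" where
  "phase_point1 p u = displacement1 p u * phase_point1_origin p * mat_adjoint (displacement1 p u)"

definition phase_space :: "nat list \<Rightarrow> (nat \<times> nat) list set" where
  "phase_space ps = {us. list_all2 (\<lambda>u p. u \<in> phase_space1 p) us ps}"

definition displacement :: "nat list \<Rightarrow> (nat \<times> nat) list \<Rightarrow> complex mat" where
  "displacement ps us = kron_list (map2 displacement1 ps us)"

definition phase_point :: "nat list \<Rightarrow> (nat \<times> nat) list \<Rightarrow> complex mat" where
  "phase_point ps us = kron_list (map2 phase_point1 ps us)"


subsection \<open>States and Wigner functions\<close>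

definition density_operator :: "nat \<Rightarrow> complex mat \<Rightarrow> bool" where
  "density_operator d \<rho> \<longleftrightarrow>
     \<rho> \<in> carrier_mat d d \<and> mat_adjoint \<rho> = \<rho> \<and>
     (\<forall>v \<in> carrier_vec d. 0 \<le> (\<rho> *\<^sub>v v) \<bullet>c v) \<and> trace \<rho> = 1"

definition wigner :: "nat list \<Rightarrow> complex mat \<Rightarrow> (nat \<times> nat) list \<Rightarrow> complex" where
  "wigner ps \<rho> us = 1 / of_nat (hdim ps) * trace (phase_point ps us * \<rho>)"

definition pwf_state :: "nat list \<Rightarrow> complex mat \<Rightarrow> bool" where
  "pwf_state ps \<rho> \<longleftrightarrow>
     density_operator (hdim ps) \<rho> \<and> (\<forall>us \<in> phase_space ps. 0 \<le> wigner ps \<rho> us)"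

definition stabilizer_state :: "nat list \<Rightarrow> complex vec \<Rightarrow> bool" where
  "stabilizer_state ps \<psi> \<longleftrightarrow>
     \<psi> \<in> carrier_vec (hdim ps) \<and> \<psi> \<bullet>c \<psi> = 1 \<and>
     (\<exists>G. finite G \<and>
          subgroup G (unitary_group (hdim ps)) \<and>
          comm_group ((unitary_group (hdim ps))\<lparr>carrier := G\<rparr>) \<and>
          (\<forall>g \<in> G. \<exists>c. \<exists>us \<in> phase_space ps. cmod c = 1 \<and> g = c \<cdot>\<^sub>m displacement ps us) \<and>
          (\<forall>c. c \<cdot>\<^sub>m 1\<^sub>m (hdim ps) \<in> G \<longrightarrow> c \<cdot>\<^sub>m 1\<^sub>m (hdim ps) = 1\<^sub>m (hdim ps)) \<and>
          ketbra \<psi> = (1 / of_nat (card G)) \<cdot>\<^sub>m mat_sum (hdim ps) (\<lambda>g. g) G)"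


subsection \<open>Subspaces and extendibility\<close>

definition hilbert_subspace :: "nat \<Rightarrow> complex vec set \<Rightarrow> bool" where
  "hilbert_subspace d S \<longleftrightarrow> VectorSpace.subspace class_ring S (module_vec TYPE(complex) d)"

definition orthonormal_basis :: "nat \<Rightarrow> complex vec set \<Rightarrow> nat \<Rightarrow> (nat \<Rightarrow> complex vec) \<Rightarrow> bool" where
  "orthonormal_basis d S n \<psi> \<longleftrightarrow>
     (\<forall>i<n. \<psi> i \<in> S) \<and>
     (\<forall>i<n. \<forall>j<n. \<psi> i \<bullet>c \<psi> j = (if i = j then 1 else 0)) \<and>
     LinearCombinations.module.span class_ring (module_vec TYPE(complex) d) (\<psi> ` {..<n}) = S"

definition orth_compl :: "nat \<Rightarrow> complex vec set \<Rightarrow> complex vec set" where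
  "orth_compl d S = {v \<in> carrier_vec d. \<forall>w \<in> S. v \<bullet>c w = 0}"

definition mat_support :: "nat \<Rightarrow> complex mat \<Rightarrow> complex vec set" where
  "mat_support d \<rho> = orth_compl d (mat_kernel \<rho>)"

definition pwf_extendible :: "nat list \<Rightarrow> complex vec set \<Rightarrow> bool" where
  "pwf_extendible ps S \<longleftrightarrow>
     (\<exists>\<rho>. pwf_state ps \<rho> \<and> mat_support (hdim ps) \<rho> \<subseteq> orth_compl (hdim ps) S)"

end

theory Submission
  imports Defs
begin

text \<open>
  The state is the normalised projection \<open>\<rho> = (1 - P) / tr (1 - P)\<close> with \<open>P = \<Sum>\<^sub>i |\<psi>\<^sub>i\<rangle>\<langle>\<psi>\<^sub>i|\<close>.
  A phase point operator \<open>A\<close> has trace 1, so \<open>W\<^sub>\<rho> \<ge> 0\<close> amounts to \<open>\<Sum>\<^sub>i \<langle>\<psi>\<^sub>i|A|\<psi>\<^sub>i\<rangle> \<le> 1\<close>. As a displaced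
  parity, \<open>A\<close> satisfies \<open>A g = \<chi>(g) g\<^sup>\<dagger> A\<close> for every multiple \<open>g\<close> of a displacement operator. If \<open>\<psi>\<close> is
  stabilized by \<open>G\<close>, averaging over \<open>G\<close> shows that \<open>\<langle>\<psi>|A|\<psi>\<rangle> \<noteq> 0\<close> forces \<open>\<chi> = 1\<close> on \<open>G\<close>, and then
  \<open>\<langle>\<psi>|A|\<psi>\<rangle> = 1\<close> because \<open>G\<close> has odd exponent. If the value is 1 for two stabilizer states with
  groups \<open>G\<close> and \<open>H\<close>, then every \<open>tr (g h)\<close> with \<open>g \<in> G\<close>, \<open>h \<in> H\<close> is nonnegative, so
  \<open>|\<langle>\<psi>|\<phi>\<rangle>|\<^sup>2 = (\<Sum>\<^sub>g\<^sub>,\<^sub>h tr (g h)) / (|G| |H|)\<close> is positive. Hence at most one of the orthogonal \<open>\<psi>\<^sub>i\<close> contributes 1.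
\<close>


subsection \<open>Matrices\<close>

lemma dim_mat_adjoint [simp]:
  "dim_row (mat_adjoint A) = dim_col A" "dim_col (mat_adjoint A) = dim_row A"
  by (simp_all add: mat_adjoint_def)

lemma mat_adjoint_carrier [simp]: "A \<in> carrier_mat m n \<Longrightarrow> mat_adjoint A \<in> carrier_mat n m"
  by (rule carrier_matI) auto

lemma index_mat_adjoint [simp]:
  fixes A :: "complex mat"
  shows "i < dim_col A \<Longrightarrow> j < dim_row A \<Longrightarrow> mat_adjoint A $$ (i, j) = cnj (A $$ (j, i))"
  by (simp add: mat_adjoint_def mat_of_rows_index)

lemma index_mult_mat_sum:
  assumes "A \<in> carrier_mat m n" "B \<in> carrier_mat n k" "i < m" "j < k"
  shows "(A * B) $$ (i, j) = (\<Sum>l<n. A $$ (i, l) * B $$ (l, j))"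
  using assms by (auto simp: scalar_prod_def atLeast0LessThan intro!: sum.cong)

lemma mat_adjoint_smult:
  fixes A :: "complex mat"
  shows "mat_adjoint (c \<cdot>\<^sub>m A) = cnj c \<cdot>\<^sub>m mat_adjoint A"
  by (rule eq_matI) auto

lemma mat_adjoint_adjoint [simp]:
  fixes A :: "complex mat"
  shows "mat_adjoint (mat_adjoint A) = A"
  by (rule eq_matI) auto

lemma trace_mult_sum:
  assumes "A \<in> carrier_mat m n" "B \<in> carrier_mat n m"
  shows "trace (A * B) = (\<Sum>i<m. \<Sum>j<n. A $$ (i, j) * B $$ (j, i))"
proof -
  have "trace (A * B) = (\<Sum>i<m. (A * B) $$ (i, i))" using assms by (simp add: trace_def)
  then show ?thesis using index_mult_mat_sum[OF assms] by simp
qed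

lemma trace_mult_commute:
  assumes "A \<in> carrier_mat m n" "B \<in> carrier_mat n m"
  shows "trace (A * B) = trace (B * A)"
  unfolding trace_mult_sum[OF assms] trace_mult_sum[OF assms(2,1)]
  by (subst sum.swap) (simp add: mult.commute)

lemma trace_smult: "trace (c \<cdot>\<^sub>m A) = c * trace A" if "A \<in> carrier_mat n n"
  using that by (simp add: trace_def sum_distrib_left)

lemma trace_one [simp]: "trace (1\<^sub>m n) = of_nat n"
  by (simp add: trace_def)

lemma smult_smult_mult:
  fixes A :: "complex mat"
  assumes "A \<in> carrier_mat m n" "B \<in> carrier_mat n k"
  shows "(a \<cdot>\<^sub>m A) * (b \<cdot>\<^sub>m B) = (a * b) \<cdot>\<^sub>m (A * B)"
  using assms by (intro eq_matI) auto

lemma smult_smult_mat [simp]: "a \<cdot>\<^sub>m (b \<cdot>\<^sub>m A) = (a * b) \<cdot>\<^sub>m (A :: complex mat)"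
  by (rule eq_matI) auto

lemma one_smult_mat [simp]: "1 \<cdot>\<^sub>m A = (A :: complex mat)"
  by (rule eq_matI) auto

text \<open>Carrier and entries are proved together, because reading an entry of the inductive sum
  requires its dimensions. After this, \<open>mat_sum\<close> is handled only through its
  entries.\<close>

lemma mat_sum_index:
  assumes "finite I" "\<And>x. x \<in> I \<Longrightarrow> f x \<in> carrier_mat d d"
  shows "mat_sum d f I \<in> carrier_mat d d \<and>
    (\<forall>i<d. \<forall>j<d. mat_sum d f I $$ (i, j) = (\<Sum>x\<in>I. f x $$ (i, j)))"
proof -
  interpret abelian_monoid "module_mat TYPE(complex) d d"
    using abelian_group_mat[of d d] abelian_group_def by blast
  show ?thesis
    using assms
  proof (induction I rule: finite_induct)
    case empty
    then show ?case using finsum_empty[of f] by (simp add: mat_sum_def) (simp add: module_mat_def)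
  next
    case (insert x F)
    have "mat_sum d f (insert x F) = f x + mat_sum d f F"
      unfolding mat_sum_def
      by (subst finsum_insert) (use insert in \<open>auto simp: module_mat_def\<close>)
    then show ?case using insert by auto
  qed
qed

lemmas mat_sum_carrier = mat_sum_index [THEN conjunct1]
lemmas index_mat_sum = mat_sum_index [THEN conjunct2, rule_format]

lemma trace_mult_mat_sum:
  assumes "finite I" "\<And>x. x \<in> I \<Longrightarrow> f x \<in> carrier_mat d d" "M \<in> carrier_mat d d"
  shows "trace (M * mat_sum d f I) = (\<Sum>x\<in>I. trace (M * f x))"
proof -
  have "trace (M * mat_sum d f I) = (\<Sum>i<d. \<Sum>j<d. \<Sum>x\<in>I. M $$ (i, j) * f x $$ (j, i))"
    using trace_mult_sum[OF assms(3) mat_sum_carrier[of I f, OF assms(1,2)]] assms(1,2)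
    by (simp add: index_mat_sum sum_distrib_left)
  also have "\<dots> = (\<Sum>i<d. \<Sum>x\<in>I. \<Sum>j<d. M $$ (i, j) * f x $$ (j, i))"
    by (intro sum.cong sum.swap refl)
  also have "\<dots> = (\<Sum>x\<in>I. \<Sum>i<d. \<Sum>j<d. M $$ (i, j) * f x $$ (j, i))"
    by (rule sum.swap)
  also have "\<dots> = (\<Sum>x\<in>I. trace (M * f x))"
    using assms by (intro sum.cong refl trace_mult_sum[symmetric])
  finally show ?thesis .
qed

lemma pow_mat_add:
  fixes A :: "complex mat"
  assumes A: "A \<in> carrier_mat n n"
  shows "A ^\<^sub>m (j + k) = A ^\<^sub>m j * A ^\<^sub>m k"
proof (induction k)
  case 0
  show ?case using A by simp
next
  case (Suc k)
  then show ?case using A by (simp add: assoc_mult_mat[of _ n n _ n _ n])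
qed

lemma pow_mat_mult:
  fixes A :: "complex mat"
  assumes A: "A \<in> carrier_mat n n"
  shows "A ^\<^sub>m (j * k) = (A ^\<^sub>m j) ^\<^sub>m k"
proof (induction k)
  case 0
  show ?case using A by simp
next
  case (Suc k)
  then show ?case
    using pow_mat_add[OF A, of "j * k" j] by (simp add: add.commute)
qed

lemma one_pow_mat [simp]: "(1\<^sub>m n :: complex mat) ^\<^sub>m k = 1\<^sub>m n"
  by (induction k) auto

lemma smult_pow_mat:
  fixes A :: "complex mat"
  assumes A: "A \<in> carrier_mat n n"
  shows "(c \<cdot>\<^sub>m A) ^\<^sub>m k = c ^ k \<cdot>\<^sub>m A ^\<^sub>m k"
proof (induction k)
  case 0
  show ?case using A by (intro eq_matI) auto
next
  case (Suc k)
  then show ?case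
    using A by (simp add: smult_smult_mult[of _ n n _ n] mult.commute)
qed


subsection \<open>Kronecker products\<close>

lemma kron_carrier [simp]:
  "A \<in> carrier_mat m n \<Longrightarrow> B \<in> carrier_mat k l \<Longrightarrow> kron A B \<in> carrier_mat (m * k) (n * l)"
  by (auto simp: kron_def)

lemma nat_mult_add_less: "i * n + j < m * n" if "i < m" "j < n" for i j m n :: nat
proof -
  have "i * n + j < Suc i * n" using that by simp
  also have "\<dots> \<le> m * n" using that by (intro mult_le_mono1) simp
  finally show ?thesis .
qed

text \<open>An index \<open>x\<close> below \<open>m * n\<close> is decoded into the pair
  \<open>(x div n, x mod n)\<close>, which is a bijection when \<open>n\<close> is nonzero; for
  \<open>n = 0\<close> both sides are empty. This is how sums over a product basis factor.\<close>

lemma sum_lessThan_mult: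
  fixes f :: "nat \<Rightarrow> nat \<Rightarrow> 'a::comm_monoid_add"
  shows "(\<Sum>x<m * n. f (x div n) (x mod n)) = (\<Sum>i<m. \<Sum>j<n. f i j)"
proof (cases "n = 0")
  case False
  have "(\<Sum>x<m * n. f (x div n) (x mod n)) = (\<Sum>(i, j)\<in>{..<m} \<times> {..<n}. f i j)"
    using False
    by (intro sum.reindex_bij_witness[where j = "\<lambda>x. (x div n, x mod n)" and i = "\<lambda>(i, j). i * n + j"])
      (auto simp: less_mult_imp_div_less intro: nat_mult_add_less)
  then show ?thesis by (simp add: sum.cartesian_product)
qed simp

lemma index_kron:
  assumes "A \<in> carrier_mat m n" "B \<in> carrier_mat k l" "i < m * k" "j < n * l"
  shows "kron A B $$ (i, j) = A $$ (i div k, j div l) * B $$ (i mod k, j mod l)"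
  using assms by (simp add: kron_def)

text \<open>The mixed-product rule: the sum over the middle index splits into a double sum, whose
  summand separates into one factor for each tensor component.\<close>

lemma kron_mult:
  assumes A: "A \<in> carrier_mat m n" and B: "B \<in> carrier_mat k l"
    and C: "C \<in> carrier_mat n p" and D: "D \<in> carrier_mat l q"
  shows "kron A B * kron C D = kron (A * C) (B * D)"
proof (rule eq_matI)
  fix i j assume "i < dim_row (kron (A * C) (B * D))" "j < dim_col (kron (A * C) (B * D))"
  then have ij: "i < m * k" "j < p * q" using assms by (auto simp: kron_def)
  \<comment> \<open>A block of size 0 would leave no index \<open>i\<close> or \<open>j\<close>;
    nonzero block sizes are what bounds the remainders.\<close>
  then have "k \<noteq> 0" "q \<noteq> 0" by (metis mult_0_right not_less_zero)+
  then have ij': "i div k < m" "i mod k < k" "j div q < p" "j mod q < q"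
    using ij by (auto simp: less_mult_imp_div_less)
  have "(kron A B * kron C D) $$ (i, j) = (\<Sum>x<n * l. kron A B $$ (i, x) * kron C D $$ (x, j))"
    using assms ij by (intro index_mult_mat_sum) auto
  also have "\<dots> = (\<Sum>x<n * l. A $$ (i div k, x div l) * B $$ (i mod k, x mod l) *
      (C $$ (x div l, j div q) * D $$ (x mod l, j mod q)))"
    using ij by (intro sum.cong) (auto simp: index_kron[OF A B] index_kron[OF C D])
  also have "\<dots> = (\<Sum>x<n. \<Sum>y<l. A $$ (i div k, x) * B $$ (i mod k, y) *
      (C $$ (x, j div q) * D $$ (y, j mod q)))"
    by (rule sum_lessThan_mult)
  also have "\<dots> = (\<Sum>x<n. A $$ (i div k, x) * C $$ (x, j div q)) *
      (\<Sum>y<l. B $$ (i mod k, y) * D $$ (y, j mod q))"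
    by (simp add: sum_product mult_ac)
  also have "\<dots> = kron (A * C) (B * D) $$ (i, j)"
    using index_kron[of "A * C" m p "B * D" k q i j] assms ij ij'
    by (simp add: index_mult_mat_sum[OF A C] index_mult_mat_sum[OF B D] del: index_mult_mat)
  finally show "(kron A B * kron C D) $$ (i, j) = kron (A * C) (B * D) $$ (i, j)" .
qed (use assms in \<open>auto simp: kron_def\<close>)

lemma trace_kron:
  assumes A: "A \<in> carrier_mat m m" and B: "B \<in> carrier_mat k k"
  shows "trace (kron A B) = trace A * trace B"
proof -
  have "trace (kron A B) = (\<Sum>x<m * k. kron A B $$ (x, x))"
    using kron_carrier[OF A B] by (simp add: trace_def)
  also have "\<dots> = (\<Sum>x<m * k. A $$ (x div k, x div k) * B $$ (x mod k, x mod k))"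
    by (intro sum.cong) (auto simp: index_kron[OF A B])
  also have "\<dots> = (\<Sum>i<m. \<Sum>j<k. A $$ (i, i) * B $$ (j, j))"
    by (rule sum_lessThan_mult)
  finally show ?thesis using A B by (simp add: trace_def sum_product)
qed

lemma kron_smult: "kron (a \<cdot>\<^sub>m A) (b \<cdot>\<^sub>m B) = (a * b) \<cdot>\<^sub>m kron A B"
proof -
  have "i div k < m" "i mod k < k" if "i < m * k" for i m k :: nat
    using that by (metis less_mult_imp_div_less, metis mod_less_divisor mult_0_right not_less_zero gr0I)
  then show ?thesis by (intro eq_matI) (auto simp: kron_def)
qed

lemma mat_adjoint_kron: "mat_adjoint (kron A B) = kron (mat_adjoint A) (mat_adjoint B)"
proof -
  have "i div k < m" "i mod k < k" if "i < m * k" for i m k :: nat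
    using that by (metis less_mult_imp_div_less, metis mod_less_divisor mult_0_right not_less_zero gr0I)
  then show ?thesis by (intro eq_matI) (auto simp: kron_def)
qed

lemma kron_one: "kron (1\<^sub>m m) (1\<^sub>m n) = 1\<^sub>m (m * n)"
proof (rule eq_matI)
  fix i j assume "i < dim_row (1\<^sub>m (m * n))" "j < dim_col (1\<^sub>m (m * n))"
  then have "i < m * n" "j < m * n" by auto
  moreover from this have "n \<noteq> 0" by (metis mult_0_right not_less_zero)
  moreover have "i = j \<longleftrightarrow> i div n = j div n \<and> i mod n = j mod n"
    by (metis div_mult_mod_eq)
  ultimately show "kron (1\<^sub>m m) (1\<^sub>m n) $$ (i, j) = 1\<^sub>m (m * n) $$ (i, j)"
    by (auto simp: kron_def less_mult_imp_div_less)
qed (auto simp: kron_def)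

lemma kron_pow:
  assumes A: "A \<in> carrier_mat m m" and B: "B \<in> carrier_mat k k"
  shows "kron A B ^\<^sub>m r = kron (A ^\<^sub>m r) (B ^\<^sub>m r)"
proof (induction r)
  case 0
  have "dim_row (kron A B) = m * k" using A B by (simp add: kron_def)
  then show ?case using A B by (simp add: kron_one)
next
  case (Suc r)
  then show ?case using A B by (simp add: kron_mult[of _ m m _ k k _ m _ k])
qed


subsection \<open>Weyl operators\<close>

definition root_char :: "nat \<Rightarrow> int \<Rightarrow> complex" where
  "root_char p x = cis (2 * pi * of_int x / of_nat p)"

lemma root_char_add: "root_char p (x + y) = root_char p x * root_char p y"
  by (simp add: root_char_def cis_mult ring_distribs add_divide_distrib)

lemma root_char_0 [simp]: "root_char p 0 = 1"
  by (simp add: root_char_def)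

lemma cnj_root_char [simp]: "cnj (root_char p x) = root_char p (- x)"
  by (simp add: root_char_def cis_cnj)

lemma root_char_minus: "root_char p (- x) * root_char p x = 1"
  unfolding root_char_add[symmetric] by simp

lemma root_char_power: "root_char p x ^ k = root_char p (int k * x)"
  by (induction k) (simp_all add: root_char_add[symmetric] ring_distribs)

text \<open>The forward direction uses only the real part: the cosine is 1 exactly at integer
  multiples of \<open>2 * pi\<close>.\<close>

lemma root_char_eq_1_iff:
  assumes "p > 0"
  shows "root_char p x = 1 \<longleftrightarrow> int p dvd x"
proof
  assume "root_char p x = 1"
  then have "cos (2 * pi * of_int x / of_nat p) = 1" by (simp add: root_char_def complex_eq_iff)
  then obtain n :: int where "2 * pi * of_int x / of_nat p = of_int n * 2 * pi"
    using cos_one_2pi_int by blast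
  then have "real_of_int x = of_int (n * int p)" using assms by (simp add: field_simps)
  then have "x = n * int p" by (simp only: of_int_eq_iff)
  then show "int p dvd x" by simp
next
  assume "int p dvd x"
  then obtain n where "x = int p * n" by (rule dvdE)
  then have "root_char p x = cis (2 * pi * of_int n)"
    unfolding root_char_def using assms by (intro arg_cong[where f = cis]) simp
  then show "root_char p x = 1" by (simp only: cis_multiple_2pi[OF Ints_of_int])
qed

lemma root_char_cong:
  assumes "p > 0" "int p dvd x - y"
  shows "root_char p x = root_char p y"
  using root_char_eq_1_iff[OF assms(1), of "x - y"] assms(2) root_char_add[of p "x - y" y] by simp

text \<open>Orthogonality of characters: this is a geometric sum whose ratio has \<open>p\<close>-th
  power 1, so it vanishes unless the ratio itself is 1.\<close>

lemma sum_root_char: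
  assumes "p > 0"
  shows "(\<Sum>j<p. root_char p (x * int j)) = (if int p dvd x then of_nat p else 0)"
proof -
  have "(\<Sum>j<p. root_char p (x * int j)) = (\<Sum>j<p. root_char p x ^ j)"
    by (simp add: root_char_power mult.commute)
  moreover have "root_char p x ^ p = 1"
    unfolding root_char_power root_char_eq_1_iff[OF assms] by simp
  ultimately show ?thesis
    using root_char_eq_1_iff[OF assms, of x] by (auto simp: sum_gp_strict)
qed

text \<open>Exactly one \<open>l\<close> below \<open>p\<close> is congruent to \<open>x\<close>,
  and periodicity of \<open>f\<close> allows evaluation at \<open>x\<close> itself. Matrix indices
  are naturals below \<open>p\<close> while the Weyl entries are governed by integer congruences;
  this evaluates their matrix products without reducing modulo \<open>p\<close>.\<close>

lemma sum_residue:
  fixes f :: "int \<Rightarrow> 'a::comm_monoid_add"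
  assumes "p > 0" "\<And>y z. int p dvd y - z \<Longrightarrow> f y = f z"
  shows "(\<Sum>l<p. if int p dvd int l - x then f (int l) else 0) = f x"
proof -
  let ?r = "nat (x mod int p)"
  have r: "?r < p" "int ?r = x mod int p"
    using assms(1) by (simp_all add: nat_less_iff)
  have "int p dvd int l - x \<longleftrightarrow> l = ?r" if "l < p" for l
  proof
    assume "int p dvd int l - x"
    then have "int l mod int p = x mod int p" by (simp add: mod_eq_dvd_iff)
    then show "l = ?r" using that by simp
  next
    assume "l = ?r"
    then show "int p dvd int l - x" using r by (simp add: mod_eq_dvd_iff[symmetric])
  qed
  then have "(\<Sum>l<p. if int p dvd int l - x then f (int l) else 0) = (\<Sum>l<p. if l = ?r then f (int l) else 0)"
    by (intro sum.cong) auto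
  also have "\<dots> = f (int ?r)" using r by simp
  also have "\<dots> = f x"
    using r by (intro assms(2)) (simp add: mod_eq_dvd_iff[symmetric])
  finally show ?thesis .
qed

text \<open>\<open>weyl p a b\<close> is \<open>Z\<^sup>a X\<^sup>b\<close>, with integer exponents so that inverses stay in the family.\<close>

definition weyl :: "nat \<Rightarrow> int \<Rightarrow> int \<Rightarrow> complex mat" where
  "weyl p a b = mat p p (\<lambda>(i, j). if int p dvd int i - int j - b then root_char p (a * int i) else 0)"

lemma weyl_carrier [simp]: "weyl p a b \<in> carrier_mat p p"
  by (simp add: weyl_def)

lemma weyl_dim [simp]: "dim_row (weyl p a b) = p" "dim_col (weyl p a b) = p"
  by (simp_all add: weyl_def)

lemma index_weyl [simp]:
  "i < p \<Longrightarrow> j < p \<Longrightarrow>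
    weyl p a b $$ (i, j) = (if int p dvd int i - int j - b then root_char p (a * int i) else 0)"
  by (simp add: weyl_def)

lemma dvd_diff_cong: "int p dvd x - y \<Longrightarrow> int p dvd x + z \<longleftrightarrow> int p dvd y + z"
proof -
  assume "int p dvd x - y"
  then have "int p dvd (x - y) + (y + z) \<longleftrightarrow> int p dvd y + z" by (rule dvd_add_right_iff)
  then show ?thesis by (simp add: algebra_simps)
qed

lemma root_char_mult_cong:
  assumes "p > 0" "int p dvd x - y"
  shows "root_char p (a * x) = root_char p (a * y)"
proof -
  have "int p dvd a * (x - y)" using assms(2) by (rule dvd_mult)
  then show ?thesis by (intro root_char_cong[OF assms(1)]) (simp add: algebra_simps)
qed

text \<open>Since \<open>X Z\<close> is \<open>root_char p (- 1)\<close> times \<open>Z X\<close>,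
  moving the \<open>b\<close> shifts of the first factor past the \<open>a'\<close> clock operators
  of the second produces the stated phase.\<close>

lemma weyl_mult:
  assumes p: "p > 0"
  shows "weyl p a b * weyl p a' b' = root_char p (- a' * b) \<cdot>\<^sub>m weyl p (a + a') (b + b')"
proof (rule eq_matI)
  fix i j assume "i < dim_row (root_char p (- a' * b) \<cdot>\<^sub>m weyl p (a + a') (b + b'))"
    "j < dim_col (root_char p (- a' * b) \<cdot>\<^sub>m weyl p (a + a') (b + b'))"
  then have ij: "i < p" "j < p" by auto
  \<comment> \<open>The summand of the product as a \<open>p\<close>-periodic function of an
    arbitrary integer middle index, in the form \<open>sum_residue\<close> expects.\<close>
  let ?f = "\<lambda>y. if int p dvd y - int j - b' then root_char p (a * int i) * root_char p (a' * y) else 0"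
  have cong: "?f y = ?f z" if "int p dvd y - z" for y z
    using dvd_diff_cong[OF that, of "- int j - b'"] root_char_mult_cong[OF p that, of a']
    by (simp add: algebra_simps)
  have "(weyl p a b * weyl p a' b') $$ (i, j) =
      (\<Sum>l<p. if int p dvd int l - (int i - b) then ?f (int l) else 0)"
  proof -
    have "int p dvd int i - int l - b \<longleftrightarrow> int p dvd int l - (int i - b)" for l
      by (metis (no_types, opaque_lifting) diff_diff_eq diff_diff_eq2 dvd_minus_iff
          minus_diff_eq add.commute)
    then show ?thesis
      using ij by (subst index_mult_mat_sum[of _ p p _ p]) (auto intro!: sum.cong)
  qed
  also have "\<dots> = ?f (int i - b)"
    by (rule sum_residue[OF p cong])
  also have "\<dots> = root_char p (- a' * b) * weyl p (a + a') (b + b') $$ (i, j)"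
    using ij by (simp add: algebra_simps flip: root_char_add)
  finally show "(weyl p a b * weyl p a' b') $$ (i, j) =
      (root_char p (- a' * b) \<cdot>\<^sub>m weyl p (a + a') (b + b')) $$ (i, j)"
    using ij by simp
qed auto

lemma weyl_cong:
  assumes "p > 0" "int p dvd a - a'" "int p dvd b - b'"
  shows "weyl p a b = weyl p a' b'"
proof (rule eq_matI)
  fix i j assume "i < dim_row (weyl p a' b')" "j < dim_col (weyl p a' b')"
  then have ij: "i < p" "j < p" by auto
  have "int p dvd - b - (- b')" using assms(3) by (metis dvd_minus_iff minus_diff_minus)
  from dvd_diff_cong[OF this, of "int i - int j"]
  show "weyl p a b $$ (i, j) = weyl p a' b' $$ (i, j)"
    using ij root_char_mult_cong[OF assms(1,2), of "int i"] by (simp add: algebra_simps)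
qed auto

lemma weyl_0_0: "weyl p 0 0 = 1\<^sub>m p"
proof (rule eq_matI)
  fix i j assume "i < dim_row (1\<^sub>m p :: complex mat)" "j < dim_col (1\<^sub>m p :: complex mat)"
  then have ij: "i < p" "j < p" by auto
  have "int p dvd int i - int j \<longleftrightarrow> i = j"
    using ij by (simp add: mod_eq_dvd_iff[symmetric])
  then show "weyl p 0 0 $$ (i, j) = 1\<^sub>m p $$ (i, j)" using ij by simp
qed auto

text \<open>The adjoint reverses the order of clock and shift operators; restoring the order costs
  the phase.\<close>

lemma mat_adjoint_weyl:
  assumes "p > 0"
  shows "mat_adjoint (weyl p a b) = root_char p (- a * b) \<cdot>\<^sub>m weyl p (- a) (- b)"
proof (rule eq_matI)
  fix i j assume "i < dim_row (root_char p (- a * b) \<cdot>\<^sub>m weyl p (- a) (- b))"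
    "j < dim_col (root_char p (- a * b) \<cdot>\<^sub>m weyl p (- a) (- b))"
  then have ij: "i < p" "j < p" by auto
  have iff: "int p dvd int j - int i - b \<longleftrightarrow> int p dvd int i - int j + b"
    by (metis (no_types, opaque_lifting) diff_diff_eq diff_diff_eq2 dvd_minus_iff minus_diff_eq
        add.commute diff_add_eq)
  have "root_char p (- (a * int j)) = root_char p (- (a * b) - a * int i)"
    if "int p dvd int j - int i - b"
    using root_char_mult_cong[OF assms, of "int j" "int i + b" "- a"] that
    by (simp add: algebra_simps)
  then show "mat_adjoint (weyl p a b) $$ (i, j) =
      (root_char p (- a * b) \<cdot>\<^sub>m weyl p (- a) (- b)) $$ (i, j)"
    using ij iff by (simp add: algebra_simps flip: root_char_add)
qed auto

text \<open>The diagonal is zero unless the shift is trivial modulo \<open>p\<close>; what remains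
  is a full character sum.\<close>

lemma trace_weyl:
  assumes p: "p > 0"
  shows "trace (weyl p a b) = (if int p dvd a \<and> int p dvd b then of_nat p else 0)"
  proof -
  have "trace (weyl p a b) = (if int p dvd b then \<Sum>j<p. root_char p (a * int j) else 0)"
    by (simp add: trace_def)
  then show ?thesis by (simp add: sum_root_char[OF p])
qed

text \<open>The phase is left unspecified: only the exponents matter for seeing that powers
  divisible by \<open>p\<close> are scalar.\<close>

lemma weyl_pow: "\<exists>c. weyl p a b ^\<^sub>m k = c \<cdot>\<^sub>m weyl p (int k * a) (int k * b)" if "p > 0"
proof (induction k)
  case 0
  show ?case by (rule exI[of _ 1]) (simp add: weyl_0_0)
next
  case (Suc k)
  then obtain c where "weyl p a b ^\<^sub>m k = c \<cdot>\<^sub>m weyl p (int k * a) (int k * b)" by blast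
  then have "weyl p a b ^\<^sub>m Suc k =
      (c * root_char p (- a * (int k * b))) \<cdot>\<^sub>m weyl p (int k * a + a) (int k * b + b)"
    by (simp add: mult_smult_assoc_mat[of _ p p _ p] weyl_mult[OF that])
  then show ?case by (auto simp: algebra_simps)
qed

lemma clock_pow: "clock_op p ^\<^sub>m k = weyl p (int k) 0" if p: "p > 0"
proof -
  have 1: "clock_op p = weyl p 1 0"
  proof (rule eq_matI)
    fix i j assume "i < dim_row (weyl p 1 0)" "j < dim_col (weyl p 1 0)"
    then have ij: "i < p" "j < p" by auto
    have "int p dvd int i - int j \<longleftrightarrow> i = j"
      using ij by (simp add: mod_eq_dvd_iff[symmetric])
    then show "clock_op p $$ (i, j) = weyl p 1 0 $$ (i, j)"
      using ij by (simp add: clock_op_def root_char_def cis_conv_exp mult_ac)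
  qed (auto simp: clock_op_def)
  show ?thesis
  proof (induction k)
    case 0
    show ?case by (simp add: weyl_0_0 clock_op_def)
  next
    case (Suc k)
    have "weyl p (int k) 0 * weyl p 1 0 = weyl p (int k + 1) 0"
      using weyl_mult[OF p, of "int k" 0 1 0] by simp
    then show ?case using Suc by (simp add: 1 add.commute)
  qed
qed

lemma shift_pow: "shift_op p ^\<^sub>m k = weyl p 0 (int k)" if p: "p > 0"
proof -
  have 1: "shift_op p = weyl p 0 1"
  proof (rule eq_matI)
    fix i j assume "i < dim_row (weyl p 0 1)" "j < dim_col (weyl p 0 1)"
    then have ij: "i < p" "j < p" by auto
    have "int p dvd int i - int j - 1 \<longleftrightarrow> int i mod int p = int (j + 1) mod int p"
      by (simp add: mod_eq_dvd_iff algebra_simps)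
    also have "\<dots> \<longleftrightarrow> i = (j + 1) mod p"
      using ij by (metis mod_less of_nat_eq_iff of_nat_mod)
    finally show "shift_op p $$ (i, j) = weyl p 0 1 $$ (i, j)"
      using ij by (simp add: shift_op_def)
  qed (auto simp: shift_op_def)
  show ?thesis
  proof (induction k)
    case 0
    show ?case by (simp add: weyl_0_0 shift_op_def)
  next
    case (Suc k)
    have "weyl p 0 (int k) * weyl p 0 1 = weyl p 0 (int k + 1)"
      using weyl_mult[OF p, of 0 "int k" 0 1] by simp
    then show ?case using Suc by (simp add: 1 add.commute)
  qed
qed

text \<open>For odd \<open>p\<close> the number \<open>p + 1\<close> is twice the integer
  \<open>(p + 1) div 2\<close>, so the half-angle phase in \<open>displacement1\<close> is a genuine
  \<open>p\<close>-th root of unity.\<close>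

lemma displacement1_eq_weyl:
  assumes "odd p"
  shows "displacement1 p (a, b) =
    root_char p (- int ((p + 1) div 2) * int a * int b) \<cdot>\<^sub>m weyl p (int a) (int b)"
proof -
  have p: "p > 0" using assms by (cases p) auto
  have h: "of_nat (p + 1) = (2 * of_nat ((p + 1) div 2) :: complex)"
    using assms by (metis dvd_mult_div_cancel even_plus_one_iff of_nat_mult of_nat_numeral)
  have "exp (- (of_nat (p + 1) * of_real pi * \<i> * of_nat a * of_nat b / of_nat p)) =
      root_char p (- int ((p + 1) div 2) * int a * int b)"
    unfolding h by (simp add: root_char_def cis_conv_exp mult_ac)
  moreover have "weyl p (int a) 0 * weyl p 0 (int b) = weyl p (int a) (int b)"
    using weyl_mult[OF p, of "int a" 0 0 "int b"] by simp
  ultimately show ?thesis by (simp only: displacement1.simps clock_pow[OF p] shift_pow[OF p])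
qed


subsection \<open>Phase point operators\<close>

text \<open>The reflection \<open>|j> -> |-j mod p>\<close>, shown below to be the phase point
  operator at the origin.\<close>

definition parity_op :: "nat \<Rightarrow> complex mat" where
  "parity_op p = mat p p (\<lambda>(i, j). if int p dvd int i + int j then 1 else 0)"

lemma parity_op_carrier [simp]: "parity_op p \<in> carrier_mat p p"
  by (simp add: parity_op_def)

text \<open>The trace counts the fixed points of \<open>j -> -j\<close>; as 2 is invertible modulo
  an odd \<open>p\<close>, the only one is 0.\<close>

lemma trace_parity_op: "odd p \<Longrightarrow> trace (parity_op p) = 1"
proof -
  assume p: "odd p"
  then have "p > 0" by (cases p) auto
  have "int p dvd int i + int i \<longleftrightarrow> i = 0" if "i < p" for i
  proof -
    have "coprime (int p) 2" using p by simp
    then have "int p dvd 2 * int i \<longleftrightarrow> int p dvd int i" by (rule coprime_dvd_mult_right_iff)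
    moreover have "int p dvd int i \<longleftrightarrow> i = 0" using that by (auto dest: dvd_imp_le)
    ultimately show ?thesis by simp
  qed
  then have "trace (parity_op p) = (\<Sum>i<p. if i = 0 then 1 else 0)"
    by (auto simp: trace_def parity_op_def intro!: sum.cong)
  then show ?thesis using \<open>p > 0\<close> by simp
qed

text \<open>Reflection inverts both position and momentum. In either product a single middle index
  survives, and both surviving entries have the same condition and phase.\<close>

lemma parity_op_weyl:
  assumes p: "p > 0"
  shows "parity_op p * weyl p a b = weyl p (- a) (- b) * parity_op p"
proof (rule eq_matI)
  fix i j assume "i < dim_row (weyl p (- a) (- b) * parity_op p)"
    "j < dim_col (weyl p (- a) (- b) * parity_op p)"
  then have ij: "i < p" "j < p" by (auto simp: parity_op_def)
  let ?f = "\<lambda>y. if int p dvd y - int j - b then root_char p (a * y) else 0"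
  let ?g = "\<lambda>y. if int p dvd y + int j then root_char p (- a * int i) else 0"
  have f: "?f y = ?f z" if "int p dvd y - z" for y z
    using dvd_diff_cong[OF that, of "- int j - b"] root_char_mult_cong[OF p that, of a]
    by (simp add: algebra_simps)
  have g: "?g y = ?g z" if "int p dvd y - z" for y z
    using dvd_diff_cong[OF that, of "int j"] by simp
  have "(parity_op p * weyl p a b) $$ (i, j) = (\<Sum>l<p. if int p dvd int l - (- int i) then ?f (int l) else 0)"
    using ij by (subst index_mult_mat_sum[of _ p p _ p])
      (auto simp: parity_op_def add.commute intro!: sum.cong)
  also have "\<dots> = ?f (- int i)"
    by (rule sum_residue[OF p f])
  also have "\<dots> = ?g (int i + b)"
  proof -
    have "int p dvd - int i - int j - b \<longleftrightarrow> int p dvd int i + b + int j"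
      by (metis (no_types, opaque_lifting) add.commute add.left_commute dvd_minus_iff
          minus_add_distrib diff_conv_add_uminus)
    then show ?thesis by simp
  qed
  also have "\<dots> = (\<Sum>l<p. if int p dvd int l - (int i + b) then ?g (int l) else 0)"
    by (rule sum_residue[OF p g, symmetric])
  also have "\<dots> = (weyl p (- a) (- b) * parity_op p) $$ (i, j)"
  proof -
    have "int p dvd int l - (int i + b) \<longleftrightarrow> int p dvd int i - int l + b" for l
      by (metis (no_types, opaque_lifting) diff_diff_eq diff_diff_eq2 dvd_minus_iff minus_diff_eq
        add.commute diff_add_eq)
    then show ?thesis
      using ij by (subst index_mult_mat_sum[of _ p p _ p])
        (auto simp: parity_op_def intro!: sum.cong)
  qed
  finally show "(parity_op p * weyl p a b) $$ (i, j) = (weyl p (- a) (- b) * parity_op p) $$ (i, j)" .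
qed (auto simp: parity_op_def)

text \<open>At entry \<open>(i, j)\<close> the sum over shifts keeps only \<open>b\<close> congruent
  to \<open>i - j\<close>. The remaining sum over \<open>a\<close> is a character sum with frequency
  \<open>(i + j) * h\<close>, which is nonzero exactly when \<open>p\<close> divides
  \<open>i + j\<close>.\<close>

lemma phase_point1_origin_eq_parity_op:
  assumes "odd p"
  shows "phase_point1_origin p = parity_op p"
proof (rule eq_matI)
  have p: "p > 0" using assms by (cases p) auto
  have fin: "finite (phase_space1 p)" by (simp add: phase_space1_def)
  have carr: "displacement1 p u \<in> carrier_mat p p" for u
    by (cases u) (simp only: displacement1_eq_weyl[OF assms] smult_carrier_mat weyl_carrier)
  show "dim_row (phase_point1_origin p) = dim_row (parity_op p)"
    "dim_col (phase_point1_origin p) = dim_col (parity_op p)"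
    using mat_sum_carrier[of "phase_space1 p" "displacement1 p" p, OF fin carr]
    by (auto simp: phase_point1_origin_def parity_op_def)
  fix i j assume "i < dim_row (parity_op p)" "j < dim_col (parity_op p)"
  then have ij: "i < p" "j < p" by (auto simp: parity_op_def)
  \<comment> \<open>\<open>h\<close> is the inverse of 2 modulo \<open>p\<close>.\<close>
  define h where "h = int ((p + 1) div 2)"
  have h: "2 * h = int p + 1" unfolding h_def using assms by presburger
  have "phase_point1_origin p $$ (i, j) = 1 / of_nat p * mat_sum p (displacement1 p) (phase_space1 p) $$ (i, j)"
    using mat_sum_carrier[of "phase_space1 p" "displacement1 p" p, OF fin carr] ij by (simp add: phase_point1_origin_def)
  also have "mat_sum p (displacement1 p) (phase_space1 p) $$ (i, j) =
      (\<Sum>u\<in>phase_space1 p. displacement1 p u $$ (i, j))"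
    using fin carr ij by (rule index_mat_sum)
  also have "\<dots> = (\<Sum>a<p. \<Sum>b<p. displacement1 p (a, b) $$ (i, j))"
    by (simp add: phase_space1_def sum.cartesian_product del: displacement1.simps)
  also have "\<dots> = (\<Sum>a<p. root_char p ((int i + int j) * h * int a))"
  proof (rule sum.cong[OF refl])
    fix a
    let ?f = "\<lambda>y. root_char p (- (h * int a) * y) * root_char p (int a * int i)"
    have f: "?f y = ?f z" if "int p dvd y - z" for y z
      using root_char_mult_cong[OF p that, of "- (h * int a)"] by simp
    have "int p dvd int i - int j - int b \<longleftrightarrow> int p dvd int b - (int i - int j)" for b
      by (metis dvd_minus_iff minus_diff_eq)
    then have "(\<Sum>b<p. displacement1 p (a, b) $$ (i, j)) =
        (\<Sum>b<p. if int p dvd int b - (int i - int j) then ?f (int b) else 0)"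
      using ij unfolding displacement1_eq_weyl[OF assms] h_def[symmetric]
      by (intro sum.cong) (auto simp: mult_ac)
    also have "\<dots> = ?f (int i - int j)"
      by (rule sum_residue[OF p f])
    also have "\<dots> = root_char p (- (h * int a) * (int i - int j) + int a * int i)"
      by (simp only: root_char_add)
    also have "\<dots> = root_char p ((int i + int j) * h * int a)"
    proof (rule root_char_cong[OF p])
      have "- (h * int a) * (int i - int j) + int a * int i - (int i + int j) * h * int a
          = int a * int i * (1 - 2 * h)" by (simp add: algebra_simps)
      then show "int p dvd - (h * int a) * (int i - int j) + int a * int i - (int i + int j) * h * int a"
        by (simp add: h)
    qed
    finally show "(\<Sum>b<p. displacement1 p (a, b) $$ (i, j)) = root_char p ((int i + int j) * h * int a)" .
  qed
  also have "\<dots> = (if int p dvd (int i + int j) * h then of_nat p else 0)"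
    by (rule sum_root_char[OF p])
  also have "int p dvd (int i + int j) * h \<longleftrightarrow> int p dvd int i + int j"
  proof -
    \<comment> \<open>This Bezout identity makes \<open>h\<close> coprime to \<open>p\<close>, so it
      can be cancelled from the divisibility condition.\<close>
    have "2 * h + (- 1) * int p = 1" using h by simp
    then have "coprime (int p) h" by (metis coprimeI dvd_add dvd_mult)
    then show ?thesis by (rule coprime_dvd_mult_left_iff)
  qed
  finally show "phase_point1_origin p $$ (i, j) = parity_op p $$ (i, j)"
    using ij p by (simp add: parity_op_def)
qed

lemma weyl_commute:
  assumes "p > 0"
  shows "\<exists>c. weyl p a b * weyl p a' b' = c \<cdot>\<^sub>m (weyl p a' b' * weyl p a b)"
proof -
  have "weyl p a b * weyl p a' b' =
      (root_char p (- a' * b) * root_char p (a * b')) \<cdot>\<^sub>m (weyl p a' b' * weyl p a b)"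
    by (simp add: weyl_mult[OF assms] add.commute flip: root_char_add)
  then show ?thesis by blast
qed

lemma phase_point1_eq:
  assumes "odd p"
  shows "\<exists>a b c. phase_point1 p u = c \<cdot>\<^sub>m (weyl p a b * parity_op p * weyl p (- a) (- b))"
proof (cases u)
  case (Pair a b)
  have p: "p > 0" using assms by (cases p) auto
  let ?r = "root_char p (- int ((p + 1) div 2) * int a * int b)"
  have "phase_point1 p u = (?r * (cnj ?r * root_char p (- int a * int b))) \<cdot>\<^sub>m
     (weyl p (int a) (int b) * parity_op p * weyl p (- int a) (- int b))"
    unfolding phase_point1_def phase_point1_origin_eq_parity_op[OF assms] Pair
      displacement1_eq_weyl[OF assms] mat_adjoint_smult mat_adjoint_weyl[OF p]
    by (simp add: mult_smult_assoc_mat[of _ p p _ p] mult_smult_distrib[of _ p p _ p]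
        mult_carrier_mat[of _ p p _ p] mult_ac)
  then show ?thesis by blast
qed

lemma phase_point1_carrier [simp]: "phase_point1 p u \<in> carrier_mat p p" if "odd p"
  using phase_point1_eq[OF that, of u] by (metis mult_carrier_mat parity_op_carrier smult_carrier_mat weyl_carrier)

text \<open>The scalar in \<open>phase_point1_eq\<close> is unspecified, so the definition is used
  instead: cyclicity of the trace and unitarity of the displacement reduce the claim to the trace of
  the reflection.\<close>

lemma trace_phase_point1:
  assumes "odd p"
  shows "trace (phase_point1 p u) = 1"
proof (cases u)
  case (Pair a b)
  have p: "p > 0" using assms by (cases p) auto
  let ?r = "root_char p (- int ((p + 1) div 2) * int a * int b)"
  let ?W = "weyl p (int a) (int b)"
  let ?T = "displacement1 p (a, b)"
  have T: "?T = ?r \<cdot>\<^sub>m ?W" by (rule displacement1_eq_weyl[OF assms])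
  then have carr: "?T \<in> carrier_mat p p" by simp
  have "mat_adjoint ?T * ?T = 1\<^sub>m p"
  proof -
    have "mat_adjoint ?T * ?T = (?r * cnj ?r * (root_char p (- int a * int b) * root_char p (int a * int b))) \<cdot>\<^sub>m 1\<^sub>m p"
      unfolding T mat_adjoint_smult mat_adjoint_weyl[OF p]
      by (simp add: smult_smult_mult[of _ p p _ p] weyl_mult[OF p] weyl_0_0 mult_ac)
    also have "\<dots> = (1::complex) \<cdot>\<^sub>m 1\<^sub>m p"
      by (simp flip: root_char_add)
    finally show ?thesis by simp
  qed
  moreover have "trace (phase_point1 p u) = trace (mat_adjoint ?T * (?T * parity_op p))"
    unfolding phase_point1_def phase_point1_origin_eq_parity_op[OF assms] Pair
    using carr by (intro trace_mult_commute[of _ p p]) (auto simp del: displacement1.simps)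
  moreover have "mat_adjoint ?T * (?T * parity_op p) = mat_adjoint ?T * ?T * parity_op p"
    using carr by (intro assoc_mult_mat[of _ p p _ p _ p, symmetric]) (auto simp del: displacement1.simps)
  ultimately show ?thesis
    using trace_parity_op[OF assms] by (simp add: left_mult_one_mat[OF parity_op_carrier])
qed

text \<open>A phase point operator is a displaced reflection. Moving a Weyl operator leftwards
  through it costs a phase at each displacement and is inverted at the reflection; the inverse is a
  phase times the adjoint.\<close>

lemma phase_point1_weyl:
  assumes "odd p"
  shows "\<exists>c. phase_point1 p u * weyl p a b = c \<cdot>\<^sub>m (mat_adjoint (weyl p a b) * phase_point1 p u)"
proof -
  have p: "p > 0" using assms by (cases p) auto
  obtain x y k where A: "phase_point1 p u = k \<cdot>\<^sub>m (weyl p x y * parity_op p * weyl p (- x) (- y))"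
    using phase_point1_eq[OF assms] by blast
  let ?W = "weyl p x y" and ?R = "parity_op p" and ?W' = "weyl p (- x) (- y)"
    and ?V = "weyl p a b" and ?V' = "weyl p (- a) (- b)"
  let ?A = "?W * ?R * ?W'"
  note smult = mult_smult_distrib[of _ p p _ p] mult_smult_assoc_mat[of _ p p _ p]
  note carr = mult_carrier_mat[of _ p p _ p]
  note assoc = assoc_mult_mat[of _ p p _ p _ p]
  obtain c where c: "?W' * ?V = c \<cdot>\<^sub>m (?V * ?W')" using weyl_commute[OF p] by blast
  obtain d where d: "?W * ?V' = d \<cdot>\<^sub>m (?V' * ?W)" using weyl_commute[OF p] by blast
  have "?A * ?V = ?W * (?R * (?W' * ?V))"
    by (simp add: assoc carr)
  also have "\<dots> = c \<cdot>\<^sub>m (?W * (?R * (?V * ?W')))"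
    by (simp add: c smult carr)
  also have "?R * (?V * ?W') = ?V' * (?R * ?W')"
    using parity_op_weyl[OF p, of a b] by (simp add: assoc[symmetric] carr)
  also have "?W * (?V' * (?R * ?W')) = (?W * ?V') * (?R * ?W')"
    by (simp add: assoc carr)
  also have "\<dots> = d \<cdot>\<^sub>m (?V' * ?A)"
    by (simp add: d assoc carr smult)
  finally have "?A * ?V = c \<cdot>\<^sub>m (d \<cdot>\<^sub>m (?V' * ?A))" .
  moreover have "?V' = root_char p (a * b) \<cdot>\<^sub>m mat_adjoint ?V"
    using root_char_minus[of p "a * b"] by (simp add: mat_adjoint_weyl[OF p] mult.commute)
  ultimately have "?A * ?V = (c * d * root_char p (a * b)) \<cdot>\<^sub>m (mat_adjoint ?V * ?A)"
    by (simp add: smult carr mult.assoc)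
  then have "phase_point1 p u * ?V = (c * d * root_char p (a * b)) \<cdot>\<^sub>m (mat_adjoint ?V * phase_point1 p u)"
    unfolding A by (simp add: smult carr mult.commute)
  then show ?thesis by blast
qed

text \<open>Scalar multiples (0 included) of tensor products of Weyl operators; the scalar sits in the base case.\<close>

fun is_weyl :: "nat list \<Rightarrow> complex mat \<Rightarrow> bool" where
  "is_weyl [] M \<longleftrightarrow> (\<exists>c. M = c \<cdot>\<^sub>m 1\<^sub>m 1)"
| "is_weyl (p # ps) M \<longleftrightarrow> (\<exists>a b N. is_weyl ps N \<and> M = kron (weyl p a b) N)"

lemma is_weyl_carrier: "is_weyl ps M \<Longrightarrow> M \<in> carrier_mat (hdim ps) (hdim ps)"
  by (induction ps arbitrary: M) auto

lemma kron_smult_right: "kron A (b \<cdot>\<^sub>m B) = b \<cdot>\<^sub>m kron A B"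
  and kron_smult_left: "kron (b \<cdot>\<^sub>m A) B = b \<cdot>\<^sub>m kron A B"
  using kron_smult[of 1 A b B] kron_smult[of b A 1 B] by simp_all

lemma is_weyl_smult: "is_weyl ps M \<Longrightarrow> is_weyl ps (c \<cdot>\<^sub>m M)"
proof (induction ps arbitrary: M)
  case Nil
  then show ?case by auto
next
  case (Cons p ps)
  then obtain a b N where N: "is_weyl ps N" "M = kron (weyl p a b) N" by auto
  have "c \<cdot>\<^sub>m M = kron (weyl p a b) (c \<cdot>\<^sub>m N)" by (simp add: N kron_smult_right)
  then show ?case using Cons.IH[OF N(1)] by auto
qed

text \<open>The phase produced by the first tensor factor is pushed into the tail, where
  \<open>is_weyl_smult\<close> carries it to the base case.\<close>

lemma is_weyl_mult:
  assumes "\<forall>p\<in>set ps. odd p"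
  shows "is_weyl ps M \<Longrightarrow> is_weyl ps N \<Longrightarrow> is_weyl ps (M * N)"
  using assms
proof (induction ps arbitrary: M N)
  case Nil
  then show ?case by (auto simp: smult_smult_mult[of _ 1 1 _ 1])
next
  case (Cons p ps)
  then have p: "p > 0" by (cases p) auto
  obtain a b M' where M: "is_weyl ps M'" "M = kron (weyl p a b) M'" using Cons by auto
  obtain a' b' N' where N: "is_weyl ps N'" "N = kron (weyl p a' b') N'" using Cons by auto
  have "M * N = kron (weyl p a b * weyl p a' b') (M' * N')"
    using is_weyl_carrier[OF M(1)] is_weyl_carrier[OF N(1)] by (simp add: M N kron_mult[of _ p p _ _ _ _ p])
  also have "\<dots> = kron (weyl p (a + a') (b + b')) (root_char p (- a' * b) \<cdot>\<^sub>m (M' * N'))"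
    by (simp add: weyl_mult[OF p] kron_smult_right kron_smult_left)
  finally have "M * N = kron (weyl p (a + a') (b + b')) (root_char p (- a' * b) \<cdot>\<^sub>m (M' * N'))" .
  moreover have "is_weyl ps (root_char p (- a' * b) \<cdot>\<^sub>m (M' * N'))"
    using Cons.IH[OF M(1) N(1)] Cons.prems by (intro is_weyl_smult) auto
  ultimately show ?case unfolding is_weyl.simps by blast
qed

text \<open>The trace is multiplicative over tensor factors, so a nonzero trace forces every Weyl
  factor to have exponents divisible by its prime, that is, to be the identity.\<close>

lemma trace_is_weyl:
  assumes "\<forall>p\<in>set ps. odd p" "is_weyl ps M"
  shows "trace M = 0 \<or> (\<exists>c. M = c \<cdot>\<^sub>m 1\<^sub>m (hdim ps))"
  using assms
proof (induction ps arbitrary: M)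
  case Nil
  then show ?case by auto
next
  case (Cons p ps)
  then have p: "p > 0" by (cases p) auto
  obtain a b N where N: "is_weyl ps N" "M = kron (weyl p a b) N" using Cons by auto
  have tr: "trace M = trace (weyl p a b) * trace N"
    using is_weyl_carrier[OF N(1)] by (simp add: N trace_kron[OF weyl_carrier])
  show ?case
  proof (cases "trace M = 0")
    case False
    then have "int p dvd a - 0" "int p dvd b - 0" using tr trace_weyl[OF p, of a b] by (auto split: if_splits)
    then have "weyl p a b = 1\<^sub>m p" using weyl_cong[OF p] weyl_0_0 by metis
    moreover obtain c where "N = c \<cdot>\<^sub>m 1\<^sub>m (hdim ps)"
      using Cons.IH[OF _ N(1)] Cons.prems False tr by auto
    ultimately have "M = c \<cdot>\<^sub>m 1\<^sub>m (hdim (p # ps))"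
      by (simp add: N kron_smult_right kron_one)
    then show ?thesis by blast
  qed simp
qed

text \<open>Each local dimension divides \<open>k\<close>, so all exponents of the power become
  trivial. Allowing any multiple \<open>k\<close> of \<open>hdim ps\<close> lets the induction pass
  to the tail with \<open>k\<close> unchanged.\<close>

lemma is_weyl_pow_scalar:
  assumes "\<forall>p\<in>set ps. odd p" "is_weyl ps M" "hdim ps dvd k"
  shows "\<exists>c. M ^\<^sub>m k = c \<cdot>\<^sub>m 1\<^sub>m (hdim ps)"
  using assms
proof (induction ps arbitrary: M)
  case Nil
  then obtain c where "M = c \<cdot>\<^sub>m 1\<^sub>m 1" by auto
  then have "M ^\<^sub>m k = c ^ k \<cdot>\<^sub>m 1\<^sub>m 1" by (simp add: smult_pow_mat[OF one_carrier_mat])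
  then show ?case by auto
next
  case (Cons p ps)
  then have p: "p > 0" by (cases p) auto
  obtain a b N where N: "is_weyl ps N" "M = kron (weyl p a b) N" using Cons by auto
  have dvd: "p dvd k" "hdim ps dvd k"
    using Cons.prems(3) by (auto dest: dvd_mult_left dvd_mult_right)
  obtain c where c: "N ^\<^sub>m k = c \<cdot>\<^sub>m 1\<^sub>m (hdim ps)"
    using Cons.IH[OF _ N(1) dvd(2)] Cons.prems by auto
  obtain d where "weyl p a b ^\<^sub>m k = d \<cdot>\<^sub>m weyl p (int k * a) (int k * b)"
    using weyl_pow[OF p] by blast
  also have "weyl p (int k * a) (int k * b) = weyl p 0 0"
    using dvd(1) by (intro weyl_cong[OF p]) auto
  finally have "M ^\<^sub>m k = (d * c) \<cdot>\<^sub>m 1\<^sub>m (hdim (p # ps))"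
    using is_weyl_carrier[OF N(1)]
    by (simp add: N kron_pow[OF weyl_carrier] c weyl_0_0 kron_smult kron_one)
  then show ?case by blast
qed

section \<open>Displacement and phase point operators of the composite system\<close>

lemma kron_list_Cons: "kron_list (A # As) = kron A (kron_list As)"
  by (simp add: kron_list_def)

lemma phase_space_induct [consumes 1, case_names Nil Cons]:
  assumes "us \<in> phase_space ps" "P [] []"
    "\<And>u us p ps. us \<in> phase_space ps \<Longrightarrow> P us ps \<Longrightarrow> P (u # us) (p # ps)"
  shows "P us ps"
proof -
  have "list_all2 (\<lambda>u p. u \<in> phase_space1 p) us ps"
    using assms(1) by (simp add: phase_space_def)
  then show ?thesis
    by (induction rule: list_all2_induct) (use assms(2,3) in \<open>auto simp: phase_space_def\<close>)
qed

lemma is_weyl_displacement: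
  assumes "us \<in> phase_space ps" "\<forall>p\<in>set ps. odd p"
  shows "is_weyl ps (displacement ps us)"
  using assms
proof (induction rule: phase_space_induct)
  case Nil
  have "(1\<^sub>m 1 :: complex mat) = 1 \<cdot>\<^sub>m 1\<^sub>m 1" by simp
  then show ?case unfolding displacement_def kron_list_def by (simp del: one_smult_mat) blast
next
  case (Cons u us p ps)
  obtain a b where u: "u = (a, b)" by (cases u)
  have "odd p" using Cons.prems by simp
  have "displacement (p # ps) (u # us) = kron (displacement1 p (a, b)) (displacement ps us)"
    by (simp add: displacement_def kron_list_Cons u del: displacement1.simps)
  also have "\<dots> = kron (weyl p (int a) (int b))
      (root_char p (- int ((p + 1) div 2) * int a * int b) \<cdot>\<^sub>m displacement ps us)"
    by (simp only: displacement1_eq_weyl[OF \<open>odd p\<close>] kron_smult_left kron_smult_right)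
  finally show ?case using is_weyl_smult[OF Cons.IH] Cons.prems by auto
qed

lemma phase_point_carrier_trace:
  assumes "us \<in> phase_space ps" "\<forall>p\<in>set ps. odd p"
  shows "phase_point ps us \<in> carrier_mat (hdim ps) (hdim ps) \<and> trace (phase_point ps us) = 1"
  using assms
proof (induction rule: phase_space_induct)
  case Nil
  show ?case by (simp add: phase_point_def kron_list_def)
next
  case (Cons u us p ps)
  have "phase_point (p # ps) (u # us) = kron (phase_point1 p u) (phase_point ps us)"
    by (simp add: phase_point_def kron_list_Cons)
  moreover have "phase_point1 p u \<in> carrier_mat p p" "trace (phase_point1 p u) = 1"
    using Cons.prems by (simp_all add: trace_phase_point1)
  moreover have "phase_point ps us \<in> carrier_mat (hdim ps) (hdim ps)" "trace (phase_point ps us) = 1"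
    using Cons by simp_all
  ultimately show ?case using trace_kron kron_carrier by simp
qed

lemmas phase_point_carrier = phase_point_carrier_trace [THEN conjunct1]
lemmas trace_phase_point = phase_point_carrier_trace [THEN conjunct2]

lemma phase_point_weyl:
  assumes "us \<in> phase_space ps" "\<forall>p\<in>set ps. odd p" "is_weyl ps M"
  shows "\<exists>c. phase_point ps us * M = c \<cdot>\<^sub>m (mat_adjoint M * phase_point ps us)"
  using assms
proof (induction arbitrary: M rule: phase_space_induct)
  case Nil
  then obtain c where M: "M = c \<cdot>\<^sub>m 1\<^sub>m 1" by auto
  \<comment> \<open>A scalar \<open>c\<close> differs from its conjugate by the factor
    \<open>c / cnj c\<close>; for \<open>c = 0\<close> both sides vanish and the factor 1 is an
    arbitrary choice.\<close>
  have "1\<^sub>m 1 * M = (if c = 0 then 1 else c / cnj c) \<cdot>\<^sub>m (mat_adjoint M * 1\<^sub>m 1)"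
    by (rule eq_matI) (auto simp: M)
  then show ?case by (simp only: phase_point_def kron_list_def list.map zip.simps foldr_Nil id_apply) blast
next
  case (Cons u us p ps)
  then obtain a b N where N: "is_weyl ps N" "M = kron (weyl p a b) N" by auto
  let ?A = "phase_point1 p u" and ?B = "phase_point ps us"
  have carr: "?A \<in> carrier_mat p p" "?B \<in> carrier_mat (hdim ps) (hdim ps)" "N \<in> carrier_mat (hdim ps) (hdim ps)"
    using Cons phase_point_carrier is_weyl_carrier[OF N(1)] by auto
  have eq: "phase_point (p # ps) (u # us) = kron ?A ?B"
    by (simp add: phase_point_def kron_list_Cons)
  obtain c where c: "?A * weyl p a b = c \<cdot>\<^sub>m (mat_adjoint (weyl p a b) * ?A)"
    using phase_point1_weyl Cons.prems by (metis list.set_intros(1))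
  obtain d where d: "?B * N = d \<cdot>\<^sub>m (mat_adjoint N * ?B)"
    using Cons.IH[OF _ N(1)] Cons.prems by auto
  have "kron ?A ?B * M = (c * d) \<cdot>\<^sub>m kron (mat_adjoint (weyl p a b) * ?A) (mat_adjoint N * ?B)"
    using carr by (simp add: N kron_mult[of _ p p _ "hdim ps" "hdim ps" _ p _ "hdim ps"] c d kron_smult)
  also have "kron (mat_adjoint (weyl p a b) * ?A) (mat_adjoint N * ?B) = mat_adjoint M * kron ?A ?B"
    using carr by (simp add: N mat_adjoint_kron kron_mult[of _ p p _ "hdim ps" "hdim ps" _ p _ "hdim ps"])
  finally show ?case unfolding eq by blast
qed


subsection \<open>Stabilizer groups\<close>

text \<open>The properties of a stabilizer group on which the argument runs. The exclusion of
  nontrivial scalars enters as \<open>pow_hdim\<close>, which says that \<open>G\<close> has odd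
  exponent.\<close>

locale weyl_group =
  fixes ps :: "nat list" and G :: "complex mat set"
  assumes odd_dims: "\<forall>p\<in>set ps. odd p"
    and finite: "finite G"
    and one: "1\<^sub>m (hdim ps) \<in> G"
    and mult: "g \<in> G \<Longrightarrow> h \<in> G \<Longrightarrow> g * h \<in> G"
    and unitary: "g \<in> G \<Longrightarrow> unitary (hdim ps) g"
    and weyl: "g \<in> G \<Longrightarrow> is_weyl ps g"
    and pow_hdim: "g \<in> G \<Longrightarrow> g ^\<^sub>m hdim ps = 1\<^sub>m (hdim ps)"
begin

abbreviation "d \<equiv> hdim ps"

lemma odd_hdim: "odd d"
  using odd_dims by (induction ps) auto

lemma carrier [simp]: "g \<in> G \<Longrightarrow> g \<in> carrier_mat d d"
  using weyl is_weyl_carrier by blast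

lemma adjoint_mult: "g \<in> G \<Longrightarrow> mat_adjoint g * g = 1\<^sub>m d" "g \<in> G \<Longrightarrow> g * mat_adjoint g = 1\<^sub>m d"
  using unitary unfolding unitary_def by auto

lemma pow: "g \<in> G \<Longrightarrow> g ^\<^sub>m k \<in> G"
  by (induction k) (auto simp: one mult carrier_matD[OF carrier])

lemma card_pos: "card G > 0"
  using finite one by (auto simp: card_gt_0_iff)

text \<open>Multiplying by the adjoint undoes the translation, so it is injective, and an injective
  self-map of a finite set is onto.\<close>

lemma bij_betw_mult:
  assumes g: "g \<in> G"
  shows "bij_betw (\<lambda>h. g * h) G G" "bij_betw (\<lambda>h. h * g) G G"
proof -
  have "mat_adjoint g * (g * h) = h" "h * g * mat_adjoint g = h" if h: "h \<in> G" for h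
  proof -
    have carr: "g \<in> carrier_mat d d" "mat_adjoint g \<in> carrier_mat d d" "h \<in> carrier_mat d d"
      using g h by auto
    show "mat_adjoint g * (g * h) = h"
      using assoc_mult_mat[OF carr(2,1,3)] adjoint_mult(1)[OF g] left_mult_one_mat[OF carr(3)] by simp
    show "h * g * mat_adjoint g = h"
      using assoc_mult_mat[OF carr(3,1,2)] adjoint_mult(2)[OF g] right_mult_one_mat[OF carr(3)] by simp
  qed
  then have "inj_on (\<lambda>h. g * h) G" "inj_on (\<lambda>h. h * g) G"
    by (auto intro: inj_on_inverseI[of _ "\<lambda>h. mat_adjoint g * h"] inj_on_inverseI[of _ "\<lambda>h. h * mat_adjoint g"])
  moreover have "(\<lambda>h. g * h) ` G \<subseteq> G" "(\<lambda>h. h * g) ` G \<subseteq> G" using g mult by auto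
  ultimately show "bij_betw (\<lambda>h. g * h) G G" "bij_betw (\<lambda>h. h * g) G G"
    using endo_inj_surj[OF finite] by (auto simp: bij_betw_def)
qed

text \<open>This is the expectation of \<open>M\<close> in the state stabilized by \<open>G\<close>,
  written with traces so that no vector is mentioned.\<close>

definition avg :: "complex mat \<Rightarrow> complex" where
  "avg M = 1 / of_nat (card G) * (\<Sum>h\<in>G. trace (M * h))"

lemma avg_smult: "M \<in> carrier_mat d d \<Longrightarrow> avg (c \<cdot>\<^sub>m M) = c * avg M"
  by (simp add: avg_def mult_smult_assoc_mat[of _ d d _ d] trace_smult[of _ d] mult_carrier_mat[of _ d d _ d]
      mult.left_commute flip: sum_distrib_left)

lemma avg_mult_right:
  assumes "g \<in> G" "M \<in> carrier_mat d d"
  shows "avg (M * g) = avg M"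
proof -
  have "(\<Sum>h\<in>G. trace (M * g * h)) = (\<Sum>h\<in>G. trace (M * (g * h)))"
    using assms by (intro sum.cong refl arg_cong[where f = trace] assoc_mult_mat[of _ d d _ d _ d]) auto
  also have "\<dots> = (\<Sum>h\<in>G. trace (M * h))"
    by (rule sum.reindex_bij_betw[OF bij_betw_mult(1)[OF assms(1)]])
  finally show ?thesis by (simp add: avg_def)
qed

text \<open>Cyclicity moves \<open>g\<close> to the right of \<open>h\<close>, after which right
  translation reindexes the sum.\<close>

lemma avg_mult_left:
  assumes "g \<in> G" "M \<in> carrier_mat d d"
  shows "avg (g * M) = avg M"
proof -
  have "(\<Sum>h\<in>G. trace (g * M * h)) = (\<Sum>h\<in>G. trace (M * (h * g)))"
  proof (rule sum.cong[OF refl])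
    fix h assume h: "h \<in> G"
    have "trace (g * M * h) = trace (g * (M * h))"
      using assms h by (simp add: assoc_mult_mat[of _ d d _ d _ d])
    also have "\<dots> = trace (M * h * g)"
      using assms h by (intro trace_mult_commute[of _ d d]) (auto intro: mult_carrier_mat)
    also have "\<dots> = trace (M * (h * g))"
      using assms h by (simp add: assoc_mult_mat[of _ d d _ d _ d])
    finally show "trace (g * M * h) = trace (M * (h * g))" .
  qed
  also have "\<dots> = (\<Sum>h\<in>G. trace (M * h))"
    by (rule sum.reindex_bij_betw[OF bij_betw_mult(2)[OF assms(1)]])
  finally show ?thesis by (simp add: avg_def)
qed

text \<open>The relation is known up to a scalar \<open>c\<close>. Averaging both sides removes
  \<open>g\<close> and its adjoint by translation invariance, leaving
  \<open>avg A = c * avg A\<close>, so a nonzero average gives \<open>c = 1\<close>.\<close>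

lemma phase_point_inverts:
  assumes us: "us \<in> phase_space ps" and nz: "avg (phase_point ps us) \<noteq> 0" and g: "g \<in> G"
  shows "phase_point ps us * g = mat_adjoint g * phase_point ps us"
proof -
  let ?A = "phase_point ps us"
  have A: "?A \<in> carrier_mat d d" using phase_point_carrier[OF us odd_dims] .
  then have gA: "mat_adjoint g * ?A \<in> carrier_mat d d" using g by (intro mult_carrier_mat[of _ d d]) auto
  obtain c where c: "?A * g = c \<cdot>\<^sub>m (mat_adjoint g * ?A)"
    using phase_point_weyl[OF us odd_dims weyl[OF g]] by blast
  have "avg ?A = avg (?A * g)" using avg_mult_right[OF g A] by simp
  also have "\<dots> = c * avg (mat_adjoint g * ?A)" by (simp add: c avg_smult[OF gA])
  also have "avg (mat_adjoint g * ?A) = avg (g * (mat_adjoint g * ?A))"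
    using avg_mult_left[OF g gA] by simp
  also have "g * (mat_adjoint g * ?A) = g * mat_adjoint g * ?A"
    using g A by (intro assoc_mult_mat[of _ d d _ d _ d, symmetric]) auto
  also have "\<dots> = ?A" using adjoint_mult(2)[OF g] A by simp
  finally have "c = 1" using nz by simp
  then show ?thesis using c by simp
qed

text \<open>Every summand \<open>trace (A * g)\<close> already equals \<open>trace A = 1\<close>, by
  writing \<open>g\<close> as a square and splitting it around \<open>A\<close>.\<close>

lemma avg_phase_point:
  assumes us: "us \<in> phase_space ps" and nz: "avg (phase_point ps us) \<noteq> 0"
  shows "avg (phase_point ps us) = 1"
proof -
  let ?A = "phase_point ps us"
  have A: "?A \<in> carrier_mat d d" using phase_point_carrier[OF us odd_dims] .
  have "trace (?A * g) = 1" if g: "g \<in> G" for g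
  proof -
    \<comment> \<open>Elements of \<open>G\<close> have odd order, hence are squares \<open>h * h\<close>, and \<open>A * h * h = h\<^sup>\<dagger> * A * h\<close>.\<close>
    define h where "h = g ^\<^sub>m ((d + 1) div 2)"
    have h: "h \<in> G" unfolding h_def by (rule pow[OF g])
    have "h * h = g ^\<^sub>m ((d + 1) div 2 + (d + 1) div 2)"
      unfolding h_def by (rule pow_mat_add[OF carrier[OF g], symmetric])
    also have "(d + 1) div 2 + (d + 1) div 2 = d + 1" using odd_hdim by presburger
    also have "g ^\<^sub>m (d + 1) = g" using left_mult_one_mat[OF carrier[OF g]] by (simp add: pow_hdim[OF g])
    finally have "trace (?A * g) = trace (?A * (h * h))" by simp
    also have "?A * (h * h) = mat_adjoint h * ?A * h"
      using h A phase_point_inverts[OF us nz h] by (simp flip: assoc_mult_mat[of ?A d d h d h d])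
    also have "\<dots> = mat_adjoint h * (?A * h)"
      using h A by (intro assoc_mult_mat[of _ d d _ d _ d]) auto
    also have "trace \<dots> = trace (?A * h * mat_adjoint h)"
      using h A by (intro trace_mult_commute[of _ d d]) (auto intro: mult_carrier_mat)
    also have "?A * h * mat_adjoint h = ?A * (h * mat_adjoint h)"
      using h A by (intro assoc_mult_mat[of _ d d _ d _ d]) auto
    also have "trace \<dots> = 1"
      using A trace_phase_point[OF us odd_dims] by (simp add: adjoint_mult[OF h])
    finally show ?thesis .
  qed
  then show ?thesis using card_pos by (simp add: avg_def)
qed

end

text \<open>All terms are nonnegative and the pair of identities contributes \<open>hdim ps\<close>.
  A nonzero term means \<open>g * h\<close> is a scalar \<open>c\<close>; the phase point operator
  forces \<open>c\<close> to be real, and the odd exponent of both groups then forces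
  \<open>c\<close> to be nonnegative.\<close>

lemma sum_trace_weyl_groups:
  assumes "weyl_group ps G" "weyl_group ps H" and us: "us \<in> phase_space ps"
    and nzG: "weyl_group.avg G (phase_point ps us) \<noteq> 0"
    and nzH: "weyl_group.avg H (phase_point ps us) \<noteq> 0"
  shows "(\<Sum>g\<in>G. \<Sum>h\<in>H. trace (g * h)) \<noteq> 0"
proof -
  interpret G: weyl_group ps G by fact
  interpret H: weyl_group ps H by fact
  define d where "d = hdim ps"
  note [simp] = d_def [symmetric]
  let ?A = "phase_point ps us"
  have A: "?A \<in> carrier_mat d d" "trace ?A = 1"
    using phase_point_carrier[OF us G.odd_dims] trace_phase_point[OF us G.odd_dims] by auto
  have d: "odd d" using G.odd_hdim by simp
  have nonneg: "0 \<le> trace (g * h)" if g: "g \<in> G" and h: "h \<in> H" for g h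
  proof (cases "trace (g * h) = 0")
    case False
    have carr: "g \<in> carrier_mat d d" "h \<in> carrier_mat d d" using g h G.carrier H.carrier by auto
    note assoc = assoc_mult_mat[of _ d d _ d _ d]
    obtain c where c: "g * h = c \<cdot>\<^sub>m 1\<^sub>m d"
      using trace_is_weyl[OF G.odd_dims is_weyl_mult[OF G.odd_dims G.weyl[OF g] H.weyl[OF h]]] False
      by auto
    have h_eq: "h = c \<cdot>\<^sub>m mat_adjoint g"
    proof -
      have "h = mat_adjoint g * g * h" using carr G.adjoint_mult(1)[OF g] by simp
      also have "\<dots> = mat_adjoint g * (g * h)" using carr by (intro assoc) auto
      finally show ?thesis using carr by (simp add: c mult_smult_distrib[of _ d d _ d])
    qed
    \<comment> \<open>Moving \<open>g * h\<close> through \<open>A\<close> inverts both factors,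
      which turns the scalar \<open>c\<close> into its conjugate.\<close>
    have "c \<cdot>\<^sub>m ?A = ?A * (g * h)" using A by (simp add: c mult_smult_distrib[of _ d d _ d])
    also have "\<dots> = ?A * g * h" using carr A by (intro assoc[symmetric]) auto
    also have "\<dots> = mat_adjoint g * (?A * h)"
      using carr A G.phase_point_inverts[OF us nzG g] by (simp add: assoc)
    also have "\<dots> = mat_adjoint g * mat_adjoint h * ?A"
      using carr A H.phase_point_inverts[OF us nzH h] by (simp add: assoc)
    also have "mat_adjoint g * mat_adjoint h = cnj c \<cdot>\<^sub>m 1\<^sub>m d"
      using carr G.adjoint_mult(1)[OF g]
      by (simp add: h_eq mat_adjoint_smult mult_smult_distrib[of _ d d _ d])
    finally have "trace (c \<cdot>\<^sub>m ?A) = trace (cnj c \<cdot>\<^sub>m ?A)"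
      using A by (simp add: mult_smult_assoc_mat[of _ d d _ d])
    then have "c = cnj c" using A by (simp add: trace_smult[of _ d])
    then obtain r where r: "c = of_real r" by (metis Reals_cnj_iff Reals_cases)
    have "1\<^sub>m d = h ^\<^sub>m d" using H.pow_hdim[OF h] by simp
    \<comment> \<open>The adjoint of \<open>g\<close> is its inverse, hence the power
      \<open>d - 1\<close> of \<open>g\<close>. The \<open>d\<close>-th power of \<open>h\<close>
      then reduces to \<open>c ^ d\<close> times the identity.\<close>
    also have "h = c \<cdot>\<^sub>m g ^\<^sub>m (d - 1)"
    proof -
      have "g * g ^\<^sub>m (d - 1) = g ^\<^sub>m d"
        using pow_mat_add[OF carr(1), of 1 "d - 1"] d carr by (cases d) auto
      then have "mat_adjoint g = mat_adjoint g * (g * g ^\<^sub>m (d - 1))"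
        using G.pow_hdim[OF g] carr by simp
      also have "\<dots> = mat_adjoint g * g * g ^\<^sub>m (d - 1)" using carr by (intro assoc[symmetric]) auto
      also have "\<dots> = g ^\<^sub>m (d - 1)" using carr G.adjoint_mult(1)[OF g] by simp
      finally show ?thesis by (simp add: h_eq)
    qed
    also have "(c \<cdot>\<^sub>m g ^\<^sub>m (d - 1)) ^\<^sub>m d = c ^ d \<cdot>\<^sub>m (g ^\<^sub>m (d * (d - 1)))"
      using carr by (simp add: smult_pow_mat[of _ d] mult.commute flip: pow_mat_mult)
    also have "\<dots> = c ^ d \<cdot>\<^sub>m 1\<^sub>m d"
      using carr G.pow_hdim[OF g] by (simp add: pow_mat_mult)
    \<comment> \<open>Entry \<open>(0, 0)\<close> exists because an odd \<open>d\<close> is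
      nonzero.\<close>
    finally have "1\<^sub>m d $$ (0, 0) = (c ^ d \<cdot>\<^sub>m 1\<^sub>m d) $$ (0, 0)" by simp
    then have "c ^ d = 1" using d by (cases d) auto
    then have "r ^ d = 1" unfolding r by (metis of_real_eq_1_iff of_real_power)
    then have "r \<ge> 0" using d by (metis zero_le_odd_power zero_le_one)
    moreover have "trace (g * h) = of_real (r * d)" by (simp add: c r trace_smult[of _ d])
    ultimately show ?thesis by (simp add: less_eq_complex_def)
  qed simp
  have one: "trace (1\<^sub>m d * 1\<^sub>m d) = of_nat d" by simp
  have "0 < (\<Sum>g\<in>G. \<Sum>h\<in>H. trace (g * h))"
  proof (rule sum_pos2[OF G.finite G.one])
    have "0 < trace (1\<^sub>m d * 1\<^sub>m d)" unfolding one using d by (cases d) (auto simp: less_complex_def)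
    then show "0 < (\<Sum>h\<in>H. trace (1\<^sub>m (hdim ps) * h))"
      using nonneg G.one by (intro sum_pos2[OF H.finite H.one]) auto
  qed (auto intro: sum_nonneg nonneg)
  then show ?thesis by simp
qed

section \<open>Stabilizer states: passing from vectors to group averages\<close>

lemma trace_ketbra_mult:
  assumes "v \<in> carrier_vec d" "w \<in> carrier_vec d"
  shows "trace (ketbra v * ketbra w) = (v \<bullet>c w) * (w \<bullet>c v)"
proof -
  have "trace (ketbra v * ketbra w) = (\<Sum>i<d. \<Sum>j<d. v $ i * cnj (v $ j) * (w $ j * cnj (w $ i)))"
    using assms by (subst trace_mult_sum[of _ d d]) (auto simp: ketbra_def)
  also have "\<dots> = (\<Sum>i<d. v $ i * cnj (w $ i)) * (\<Sum>j<d. w $ j * cnj (v $ j))"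
    by (simp add: sum_product mult_ac)
  also have "\<dots> = (v \<bullet>c w) * (w \<bullet>c v)"
    using assms by (simp add: scalar_prod_def atLeast0LessThan)
  finally show ?thesis .
qed

lemma stabilizer_state_weyl_group:
  assumes odd: "\<forall>p\<in>set ps. odd p" and "stabilizer_state ps \<psi>"
  obtains G where "weyl_group ps G"
    "\<And>M. M \<in> carrier_mat (hdim ps) (hdim ps) \<Longrightarrow> trace (M * ketbra \<psi>) = weyl_group.avg G M"
proof -
  let ?d = "hdim ps"
  from assms(2) obtain G where G: "finite G" "subgroup G (unitary_group ?d)"
      "\<forall>g\<in>G. \<exists>c. \<exists>us\<in>phase_space ps. cmod c = 1 \<and> g = c \<cdot>\<^sub>m displacement ps us"
      "\<forall>c. c \<cdot>\<^sub>m 1\<^sub>m ?d \<in> G \<longrightarrow> c \<cdot>\<^sub>m 1\<^sub>m ?d = 1\<^sub>m ?d"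
    and ket: "ketbra \<psi> = (1 / of_nat (card G)) \<cdot>\<^sub>m mat_sum ?d (\<lambda>g. g) G"
    unfolding stabilizer_state_def by blast
  have weyl: "is_weyl ps g" if "g \<in> G" for g
    using bspec[OF G(3) that] is_weyl_smult[OF is_weyl_displacement[OF _ odd]] by auto
  have carr: "g \<in> carrier_mat ?d ?d" if "g \<in> G" for g
    using is_weyl_carrier[OF weyl[OF that]] .
  have one: "1\<^sub>m ?d \<in> G"
    using subgroup.one_closed[OF G(2)] by (simp add: unitary_group_def ring_mat_def)
  have mult: "g * h \<in> G" if "g \<in> G" "h \<in> G" for g h
    using subgroup.m_closed[OF G(2) that] by (simp add: unitary_group_def ring_mat_def)
  have unitary: "unitary ?d g" if "g \<in> G" for g
    using subgroup.mem_carrier[OF G(2) that] by (simp add: unitary_group_def)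
  have pow: "g ^\<^sub>m k \<in> G" if "g \<in> G" for g k
    using that by (induction k) (auto simp: one mult carrier_matD[OF carr])
  \<comment> \<open>This power is a scalar by \<open>is_weyl_pow_scalar\<close> and lies in
    \<open>G\<close>, whose only scalar is the identity.\<close>
  have "g ^\<^sub>m ?d = 1\<^sub>m ?d" if "g \<in> G" for g
    using is_weyl_pow_scalar[OF odd weyl[OF that], of ?d] pow[OF that, of ?d] G(4) by auto
  then have group: "weyl_group ps G"
    using odd G(1) one mult unitary weyl by unfold_locales auto
  have "trace (M * ketbra \<psi>) = weyl_group.avg G M" if M: "M \<in> carrier_mat ?d ?d" for M
  proof -
    have "mat_sum ?d (\<lambda>g. g) G \<in> carrier_mat ?d ?d"
      using G(1) carr by (rule mat_sum_carrier)
    then have "trace (M * ketbra \<psi>) = 1 / of_nat (card G) * trace (M * mat_sum ?d (\<lambda>g. g) G)"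
      using trace_smult[of "M * mat_sum ?d (\<lambda>g. g) G" ?d] M
      by (simp add: ket mult_smult_distrib[of _ ?d ?d _ ?d] mult_carrier_mat[of _ ?d ?d _ ?d])
    also have "trace (M * mat_sum ?d (\<lambda>g. g) G) = (\<Sum>g\<in>G. trace (M * g))"
      using G(1) carr M by (rule trace_mult_mat_sum)
    finally show ?thesis by (simp add: weyl_group.avg_def[OF group])
  qed
  then show ?thesis using that[OF group] by blast
qed

lemma trace_phase_point_stabilizer:
  assumes "\<forall>p\<in>set ps. odd p" "stabilizer_state ps \<psi>" "us \<in> phase_space ps"
  shows "trace (phase_point ps us * ketbra \<psi>) \<in> {0, 1}"
proof -
  obtain G where G: "weyl_group ps G"
    "\<And>M. M \<in> carrier_mat (hdim ps) (hdim ps) \<Longrightarrow> trace (M * ketbra \<psi>) = weyl_group.avg G M"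
    using stabilizer_state_weyl_group[OF assms(1,2)] by metis
  show ?thesis
    using weyl_group.avg_phase_point[OF G(1) assms(3)] G(2)[OF phase_point_carrier[OF assms(3,1)]]
    by auto
qed

text \<open>The vanishing overlap equals, up to a positive factor, the double sum of traces over
  both groups. Two nonzero expectations would make that sum nonzero by
  \<open>sum_trace_weyl_groups\<close>.\<close>

lemma trace_phase_point_orthogonal:
  assumes odd: "\<forall>p\<in>set ps. odd p" and stab: "stabilizer_state ps \<psi>" "stabilizer_state ps \<phi>"
    and us: "us \<in> phase_space ps" and orth: "\<psi> \<bullet>c \<phi> = 0"
  shows "trace (phase_point ps us * ketbra \<psi>) = 0 \<or> trace (phase_point ps us * ketbra \<phi>) = 0"
proof (rule ccontr)
  assume neg: "\<not> ?thesis"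
  let ?d = "hdim ps"
  obtain G where G: "weyl_group ps G"
    "\<And>M. M \<in> carrier_mat ?d ?d \<Longrightarrow> trace (M * ketbra \<psi>) = weyl_group.avg G M"
    using stabilizer_state_weyl_group[OF odd stab(1)] by metis
  obtain H where H: "weyl_group ps H"
    "\<And>M. M \<in> carrier_mat ?d ?d \<Longrightarrow> trace (M * ketbra \<phi>) = weyl_group.avg H M"
    using stabilizer_state_weyl_group[OF odd stab(2)] by metis
  have carr: "\<psi> \<in> carrier_vec ?d" "\<phi> \<in> carrier_vec ?d" using stab by (auto simp: stabilizer_state_def)
  have ket: "ketbra \<psi> \<in> carrier_mat ?d ?d" "ketbra \<phi> \<in> carrier_mat ?d ?d"
    using carr by (auto simp: ketbra_def)
  have "0 = trace (ketbra \<psi> * ketbra \<phi>)" using trace_ketbra_mult[OF carr] orth by simp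
  also have "\<dots> = 1 / of_nat (card H) * (\<Sum>h\<in>H. trace (h * ketbra \<psi>))"
    unfolding H(2)[OF ket(1)] weyl_group.avg_def[OF H(1)]
    using trace_mult_commute[OF ket(1) weyl_group.carrier[OF H(1)]] by simp
  also have "(\<Sum>h\<in>H. trace (h * ketbra \<psi>)) = (\<Sum>h\<in>H. 1 / of_nat (card G) * (\<Sum>g\<in>G. trace (h * g)))"
    by (intro sum.cong refl) (simp add: G(2) weyl_group.carrier[OF H(1)] weyl_group.avg_def[OF G(1)])
  finally have "(\<Sum>h\<in>H. \<Sum>g\<in>G. trace (h * g)) = 0"
    using weyl_group.card_pos[OF G(1)] weyl_group.card_pos[OF H(1)] by (simp flip: sum_distrib_left sum_divide_distrib)
  moreover have "phase_point ps us \<in> carrier_mat ?d ?d" by (rule phase_point_carrier[OF us odd])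
  ultimately show False
    using sum_trace_weyl_groups[OF H(1) G(1) us] neg G(2) H(2) by auto
qed


subsection \<open>Projection onto the orthogonal complement\<close>

locale orthonormal_family =
  fixes d n :: nat and \<psi> :: "nat \<Rightarrow> complex vec"
  assumes vec: "k < n \<Longrightarrow> \<psi> k \<in> carrier_vec d"
    and orthonormal: "k < n \<Longrightarrow> l < n \<Longrightarrow> \<psi> k \<bullet>c \<psi> l = (if k = l then 1 else 0)"
begin

abbreviation span_family :: "complex vec set" where
  "span_family \<equiv> LinearCombinations.module.span class_ring (module_vec TYPE(complex) d) (\<psi> ` {..<n})"

lemma cscalar_sum: "w \<in> carrier_vec d \<Longrightarrow> v \<bullet>c w = (\<Sum>i<d. v $ i * cnj (w $ i))"
  by (auto simp: scalar_prod_def atLeast0LessThan intro!: sum.cong)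

lemma inj_family: "inj_on \<psi> {..<n}"
proof (rule inj_onI)
  fix k l assume "k \<in> {..<n}" "l \<in> {..<n}" "\<psi> k = \<psi> l"
  then show "k = l" using orthonormal[of k l] orthonormal[of k k] by (auto split: if_splits)
qed

text \<open>Library linear combinations have coefficients attached to vectors; injectivity of the
  family allows coefficients attached to indices instead.\<close>

lemma span_family_iff:
  "w \<in> span_family \<longleftrightarrow> w \<in> carrier_vec d \<and> (\<exists>c. \<forall>i<d. w $ i = (\<Sum>k<n. c k * \<psi> k $ i))"
proof -
  interpret V: vec_space "TYPE(complex)" d .
  have sub: "\<psi> ` {..<n} \<subseteq> carrier_vec d" using vec by auto
  have lincomb: "V.lincomb a (\<psi> ` {..<n}) $ i = (\<Sum>k<n. a (\<psi> k) * \<psi> k $ i)" if "i < d" for a i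
    using V.lincomb_index[OF that sub] by (simp add: sum.reindex[OF inj_family])
  have carr: "V.lincomb a (\<psi> ` {..<n}) \<in> carrier_vec d" for a
    using V.lincomb_closed[OF sub] by simp
  have span: "w \<in> span_family \<longleftrightarrow> (\<exists>a. w = V.lincomb a (\<psi> ` {..<n}))"
    using V.finite_span[OF _ sub] by auto
  show ?thesis
  proof
    assume "w \<in> span_family"
    then obtain a where "w = V.lincomb a (\<psi> ` {..<n})" unfolding span by blast
    then show "w \<in> carrier_vec d \<and> (\<exists>c. \<forall>i<d. w $ i = (\<Sum>k<n. c k * \<psi> k $ i))"
      using carr lincomb by (auto intro: exI[of _ "\<lambda>k. a (\<psi> k)"])
  next
    assume "w \<in> carrier_vec d \<and> (\<exists>c. \<forall>i<d. w $ i = (\<Sum>k<n. c k * \<psi> k $ i))"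
    then obtain c where w: "w \<in> carrier_vec d" and c: "\<forall>i<d. w $ i = (\<Sum>k<n. c k * \<psi> k $ i)"
      by blast
    \<comment> \<open>\<open>inv_into\<close> recovers the index of a family member, turning index
      coefficients back into vector coefficients.\<close>
    have "w = V.lincomb (\<lambda>x. c (inv_into {..<n} \<psi> x)) (\<psi> ` {..<n})"
    proof (rule eq_vecI)
      fix i assume "i < dim_vec (V.lincomb (\<lambda>x. c (inv_into {..<n} \<psi> x)) (\<psi> ` {..<n}))"
      then have "i < d" using carr carrier_vecD by metis
      then show "w $ i = V.lincomb (\<lambda>x. c (inv_into {..<n} \<psi> x)) (\<psi> ` {..<n}) $ i"
        by (simp add: c lincomb inv_into_f_f[OF inj_family])
    next
      show "dim_vec w = dim_vec (V.lincomb (\<lambda>x. c (inv_into {..<n} \<psi> x)) (\<psi> ` {..<n}))"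
        using w carr carrier_vecD by metis
    qed
    then show "w \<in> span_family" unfolding span by blast
  qed
qed

text \<open>The orthogonal projection onto the complement of the span, not onto the span
  itself.\<close>

definition proj :: "complex mat" where
  "proj = mat d d (\<lambda>(i, j). (if i = j then 1 else 0) - (\<Sum>k<n. \<psi> k $ i * cnj (\<psi> k $ j)))"

lemma proj_carrier [simp]: "proj \<in> carrier_mat d d"
  by (simp add: proj_def)

lemma mat_adjoint_proj: "mat_adjoint proj = proj"
  by (rule eq_matI) (auto simp: proj_def mult.commute)

lemma proj_vec_carrier [simp]: "v \<in> carrier_vec d \<Longrightarrow> proj *\<^sub>v v \<in> carrier_vec d"
  using proj_carrier by (rule mult_mat_vec_carrier)

lemma index_proj_vec:
  assumes v: "v \<in> carrier_vec d" and i: "i < d"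
  shows "(proj *\<^sub>v v) $ i = v $ i - (\<Sum>k<n. (v \<bullet>c \<psi> k) * \<psi> k $ i)"
proof -
  have "(proj *\<^sub>v v) $ i = (\<Sum>j<d. ((if i = j then 1 else 0) - (\<Sum>k<n. \<psi> k $ i * cnj (\<psi> k $ j))) * v $ j)"
    using v i by (auto simp: proj_def scalar_prod_def atLeast0LessThan intro!: sum.cong)
  also have "\<dots> = (\<Sum>j<d. if i = j then v $ j else 0) - (\<Sum>j<d. \<Sum>k<n. \<psi> k $ i * cnj (\<psi> k $ j) * v $ j)"
    unfolding sum_subtractf[symmetric]
    by (intro sum.cong) (auto simp: left_diff_distrib sum_distrib_right)
  also have "(\<Sum>j<d. \<Sum>k<n. \<psi> k $ i * cnj (\<psi> k $ j) * v $ j) =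
      (\<Sum>k<n. \<Sum>j<d. \<psi> k $ i * cnj (\<psi> k $ j) * v $ j)"
    by (rule sum.swap)
  also have "\<dots> = (\<Sum>k<n. (v \<bullet>c \<psi> k) * \<psi> k $ i)"
    by (intro sum.cong refl) (simp add: cscalar_sum vec sum_distrib_left sum_distrib_right mult_ac)
  finally show ?thesis using i by simp
qed

lemma proj_orthogonal:
  assumes v: "v \<in> carrier_vec d" and l: "l < n"
  shows "(proj *\<^sub>v v) \<bullet>c \<psi> l = 0"
proof -
  have "(proj *\<^sub>v v) \<bullet>c \<psi> l = (\<Sum>i<d. (v $ i - (\<Sum>k<n. (v \<bullet>c \<psi> k) * \<psi> k $ i)) * cnj (\<psi> l $ i))"
    by (simp add: cscalar_sum[OF vec[OF l]] index_proj_vec[OF v])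
  also have "\<dots> = v \<bullet>c \<psi> l - (\<Sum>i<d. \<Sum>k<n. (v \<bullet>c \<psi> k) * (\<psi> k $ i * cnj (\<psi> l $ i)))"
    by (simp add: cscalar_sum[OF vec[OF l]] left_diff_distrib sum_subtractf sum_distrib_right mult.assoc)
  also have "(\<Sum>i<d. \<Sum>k<n. (v \<bullet>c \<psi> k) * (\<psi> k $ i * cnj (\<psi> l $ i))) =
      (\<Sum>k<n. \<Sum>i<d. (v \<bullet>c \<psi> k) * (\<psi> k $ i * cnj (\<psi> l $ i)))"
    by (rule sum.swap)
  also have "\<dots> = (\<Sum>k<n. (v \<bullet>c \<psi> k) * (\<psi> k \<bullet>c \<psi> l))"
    by (simp add: cscalar_sum[OF vec[OF l]] sum_distrib_left)
  also have "\<dots> = (\<Sum>k<n. if k = l then v \<bullet>c \<psi> k else 0)"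
    using orthonormal l by (intro sum.cong) auto
  also have "\<dots> = v \<bullet>c \<psi> l" using l by simp
  finally show ?thesis by simp
qed

text \<open>The difference of \<open>v\<close> and its projection is a combination of the family,
  hence orthogonal to the projection. Turning the quadratic form into a squared norm gives
  positivity and detects the kernel.\<close>

lemma cscalar_proj:
  assumes v: "v \<in> carrier_vec d"
  shows "(proj *\<^sub>v v) \<bullet>c v = (proj *\<^sub>v v) \<bullet>c (proj *\<^sub>v v)"
proof -
  let ?q = "proj *\<^sub>v v"
  have "?q \<bullet>c ?q = (\<Sum>i<d. ?q $ i * cnj (v $ i - (\<Sum>k<n. (v \<bullet>c \<psi> k) * \<psi> k $ i)))"
    using v by (simp add: cscalar_sum index_proj_vec del: complex_cnj_diff)
  also have "\<dots> = ?q \<bullet>c v - (\<Sum>i<d. \<Sum>k<n. cnj (v \<bullet>c \<psi> k) * (?q $ i * cnj (\<psi> k $ i)))"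
    using v by (simp add: cscalar_sum right_diff_distrib sum_subtractf sum_distrib_left mult_ac)
  also have "(\<Sum>i<d. \<Sum>k<n. cnj (v \<bullet>c \<psi> k) * (?q $ i * cnj (\<psi> k $ i))) =
      (\<Sum>k<n. \<Sum>i<d. cnj (v \<bullet>c \<psi> k) * (?q $ i * cnj (\<psi> k $ i)))"
    by (rule sum.swap)
  also have "\<dots> = (\<Sum>k<n. cnj (v \<bullet>c \<psi> k) * (?q \<bullet>c \<psi> k))"
    by (intro sum.cong refl) (simp add: cscalar_sum[OF vec] sum_distrib_left)
  also have "\<dots> = 0" by (simp add: proj_orthogonal[OF v])
  finally show ?thesis by simp
qed

lemma cscalar_proj_nonneg: "v \<in> carrier_vec d \<Longrightarrow> 0 \<le> (proj *\<^sub>v v) \<bullet>c v"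
  unfolding cscalar_proj by (rule conjugate_square_ge_0_vec)

text \<open>A vanishing projection exhibits \<open>v\<close> as the combination with coefficients
  \<open>v \<bullet>c \<psi> k\<close>. Conversely a vector of the span is orthogonal to its own
  projection, whose squared norm is therefore 0.\<close>

lemma proj_eq_0_iff:
  assumes v: "v \<in> carrier_vec d"
  shows "proj *\<^sub>v v = 0\<^sub>v d \<longleftrightarrow> v \<in> span_family"
proof
  assume "proj *\<^sub>v v = 0\<^sub>v d"
  then have "\<forall>i<d. v $ i = (\<Sum>k<n. (v \<bullet>c \<psi> k) * \<psi> k $ i)"
    using index_proj_vec[OF v] by simp
  then show "v \<in> span_family"
    using v unfolding span_family_iff by (intro conjI exI[of _ "\<lambda>k. v \<bullet>c \<psi> k"])
next
  assume "v \<in> span_family"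
  then obtain c where c: "\<forall>i<d. v $ i = (\<Sum>k<n. c k * \<psi> k $ i)"
    unfolding span_family_iff by blast
  let ?q = "proj *\<^sub>v v"
  have "?q \<bullet>c v = (\<Sum>i<d. \<Sum>k<n. cnj (c k) * (?q $ i * cnj (\<psi> k $ i)))"
    by (simp add: cscalar_sum[OF v] c sum_distrib_left mult_ac del: index_mult_mat_vec)
  also have "\<dots> = (\<Sum>k<n. \<Sum>i<d. cnj (c k) * (?q $ i * cnj (\<psi> k $ i)))"
    by (rule sum.swap)
  also have "\<dots> = (\<Sum>k<n. cnj (c k) * (?q \<bullet>c \<psi> k))"
    by (intro sum.cong refl) (simp add: cscalar_sum[OF vec] sum_distrib_left)
  also have "\<dots> = 0" by (simp add: proj_orthogonal[OF v])
  finally show "?q = 0\<^sub>v d"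
    using v cscalar_proj conjugate_square_eq_0_vec[OF proj_vec_carrier[OF v]] by simp
qed

lemma trace_mult_proj:
  assumes A: "A \<in> carrier_mat d d"
  shows "trace (A * proj) = trace A - (\<Sum>k<n. trace (A * ketbra (\<psi> k)))"
proof -
  have ket: "trace (A * ketbra (\<psi> k)) = (\<Sum>i<d. \<Sum>j<d. A $$ (i, j) * (\<psi> k $ j * cnj (\<psi> k $ i)))"
    if "k < n" for k
    using vec[OF that] A by (subst trace_mult_sum[of _ d d]) (auto simp: ketbra_def)
  have "trace (A * proj) = (\<Sum>i<d. \<Sum>j<d. A $$ (i, j) *
      ((if j = i then 1 else 0) - (\<Sum>k<n. \<psi> k $ j * cnj (\<psi> k $ i))))"
    by (subst trace_mult_sum[OF A proj_carrier]) (simp add: proj_def)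
  also have "\<dots> = (\<Sum>i<d. \<Sum>j<d. if j = i then A $$ (i, j) else 0) -
      (\<Sum>i<d. \<Sum>j<d. \<Sum>k<n. A $$ (i, j) * (\<psi> k $ j * cnj (\<psi> k $ i)))"
    unfolding sum_subtractf[symmetric]
    by (intro sum.cong) (auto simp: right_diff_distrib sum_distrib_left)
  also have "(\<Sum>i<d. \<Sum>j<d. if j = i then A $$ (i, j) else 0) = trace A"
    using A by (simp add: trace_def)
  also have "(\<Sum>i<d. \<Sum>j<d. \<Sum>k<n. A $$ (i, j) * (\<psi> k $ j * cnj (\<psi> k $ i))) =
      (\<Sum>k<n. \<Sum>i<d. \<Sum>j<d. A $$ (i, j) * (\<psi> k $ j * cnj (\<psi> k $ i)))"
    by (subst sum.swap[of _ "{..<n}"]) (intro sum.cong refl sum.swap)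
  also have "\<dots> = (\<Sum>k<n. trace (A * ketbra (\<psi> k)))"
    by (simp add: ket)
  finally show ?thesis .
qed

text \<open>Diagonal entries are squared norms of the columns. A zero trace would make every column
  vanish, and with it the image of \<open>v\<close>, placing \<open>v\<close> in the span.\<close>

lemma trace_proj_pos:
  assumes v: "v \<in> carrier_vec d" "v \<notin> span_family"
  shows "0 < trace proj"
proof -
  have diag: "proj $$ (i, i) = (proj *\<^sub>v unit_vec d i) \<bullet>c unit_vec d i" if "i < d" for i
  proof -
    have "(proj *\<^sub>v unit_vec d i) \<bullet>c unit_vec d i = (\<Sum>j<d. if j = i then proj $$ (j, i) else 0)"
      unfolding cscalar_sum[OF unit_vec_carrier] using that
      by (intro sum.cong refl) (simp add: proj_def)
    then show ?thesis using that by simp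
  qed
  have nonneg: "0 \<le> proj $$ (i, i)" if "i < d" for i
    unfolding diag[OF that] by (rule cscalar_proj_nonneg) simp
  then have "0 \<le> trace proj" by (auto simp: trace_def proj_def intro!: sum_nonneg)
  moreover have "trace proj \<noteq> 0"
  proof
    assume "trace proj = 0"
    then have "(\<Sum>i<d. proj $$ (i, i)) = 0" by (simp add: trace_def proj_def)
    then have zero: "proj $$ (i, i) = 0" if "i < d" for i
      using that nonneg by (subst (asm) sum_nonneg_eq_0_iff) auto
    have col: "proj *\<^sub>v unit_vec d i = 0\<^sub>v d" if "i < d" for i
      using zero[OF that] diag[OF that] cscalar_proj[of "unit_vec d i"]
        conjugate_square_eq_0_vec[of "proj *\<^sub>v unit_vec d i" d] by simp
    have "proj $$ (j, i) = 0" if "i < d" "j < d" for i j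
      using arg_cong[OF col[OF that(1)], of "\<lambda>w. w $ j"] that by (simp add: proj_def)
    then have "proj *\<^sub>v v = 0\<^sub>v d"
      using v(1) proj_carrier by (intro eq_vecI) (auto simp: scalar_prod_def carrier_matD[OF proj_carrier])
    then show False using v proj_eq_0_iff by blast
  qed
  ultimately show ?thesis by order
qed

end

section \<open>The normalised complement projection as a PWF state\<close>

theorem theorem6:
  fixes ps :: "nat list" and S :: "complex vec set"
    and n :: nat and \<psi> :: "nat \<Rightarrow> complex vec"
  assumes "ps \<noteq> []"
    and "\<forall>p \<in> set ps. prime p \<and> odd p"
    and "hilbert_subspace (hdim ps) S"
    and "S \<noteq> carrier_vec (hdim ps)"
    and "orthonormal_basis (hdim ps) S n \<psi>"
    and "\<forall>i<n. stabilizer_state ps (\<psi> i)"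
  shows "pwf_extendible ps S"
proof -
  let ?d = "hdim ps"
  have odd: "\<forall>p\<in>set ps. odd p" using assms(2) by blast
  have orthonormal: "\<psi> k \<bullet>c \<psi> l = (if k = l then 1 else 0)" if "k < n" "l < n" for k l
    using assms(5) that by (simp add: orthonormal_basis_def)
  interpret orthonormal_family ?d n \<psi>
    using assms(6) orthonormal by unfold_locales (auto simp: stabilizer_state_def)
  have S: "S = span_family" using assms(5) by (simp add: orthonormal_basis_def)
  then have S_carrier: "w \<in> carrier_vec ?d" if "w \<in> S" for w
    using that span_family_iff by blast
  \<comment> \<open>Properness of \<open>S\<close> supplies a vector outside the span, so the trace
    used for normalisation is positive.\<close>
  with assms(4) obtain v where "v \<in> carrier_vec ?d" "v \<notin> S" by blast
  then have pos: "0 < trace proj" using trace_proj_pos S by blast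
  define c where "c = 1 / trace proj"
  have c: "0 < c" "cnj c = c" "c * trace proj = 1"
    using pos by (auto simp: c_def less_complex_def complex_eq_iff Re_divide Im_divide power2_eq_square)
  define \<rho> where "\<rho> = c \<cdot>\<^sub>m proj"
  have \<rho>: "\<rho> \<in> carrier_mat ?d ?d" by (simp add: \<rho>_def)
  have \<rho>_vec: "\<rho> *\<^sub>v w = c \<cdot>\<^sub>v (proj *\<^sub>v w)" if "w \<in> carrier_vec ?d" for w
    unfolding \<rho>_def using that
    by (intro eq_vecI) (auto simp: scalar_prod_def sum_distrib_left mult.assoc carrier_matD[OF proj_carrier])
  have "density_operator ?d \<rho>"
    unfolding density_operator_def
  proof (intro conjI ballI)
    show "mat_adjoint \<rho> = \<rho>" by (simp add: \<rho>_def mat_adjoint_smult mat_adjoint_proj c)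
    show "trace \<rho> = 1" unfolding \<rho>_def trace_smult[OF proj_carrier] by (rule c)
    fix w :: "complex vec" assume w: "w \<in> carrier_vec ?d"
    have "(\<rho> *\<^sub>v w) \<bullet>c w = c * ((proj *\<^sub>v w) \<bullet>c w)"
      using w unfolding cscalar_sum[OF w] \<rho>_vec[OF w]
      by (simp add: sum_distrib_left mult.assoc carrier_matD[OF proj_carrier] del: index_mult_mat_vec)
    then show "0 \<le> (\<rho> *\<^sub>v w) \<bullet>c w"
      using c(1) cscalar_proj_nonneg[OF w] by simp
  qed (rule \<rho>)
  moreover have "0 \<le> wigner ps \<rho> us" if us: "us \<in> phase_space ps" for us
  proof -
    let ?A = "phase_point ps us"
    define t where "t k = trace (?A * ketbra (\<psi> k))" for k
    have A: "?A \<in> carrier_mat ?d ?d" "trace ?A = 1"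
      using phase_point_carrier[OF us odd] trace_phase_point[OF us odd] .
    have t: "t k \<in> {0, 1}" if "k < n" for k
      unfolding t_def using trace_phase_point_stabilizer[OF odd _ us] assms(6) that by blast
    have disjoint: "t k = 0 \<or> t l = 0" if "k < n" "l < n" "k \<noteq> l" for k l
      unfolding t_def using assms(6) orthonormal[OF that(1,2)] that
      by (intro trace_phase_point_orthogonal[OF odd _ _ us]) auto
    \<comment> \<open>Each \<open>t k\<close> is 0 or 1 and no two are nonzero, so the sum is either
      0 or the single surviving 1.\<close>
    have "(\<Sum>k<n. t k) \<le> 1"
    proof (cases "\<exists>l<n. t l \<noteq> 0")
      case True
      then obtain l where l: "l < n" "t l \<noteq> 0" by blast
      then have "(\<Sum>k<n. t k) = (\<Sum>k<n. if k = l then t k else 0)"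
        using disjoint[of _ l] by (intro sum.cong) auto
      also have "\<dots> = 1" using l t[OF l(1)] by simp
      finally show ?thesis by simp
    qed (simp add: less_eq_complex_def)
    moreover have "trace (?A * \<rho>) = c * (1 - (\<Sum>k<n. t k))"
    proof -
      have "?A * \<rho> = c \<cdot>\<^sub>m (?A * proj)"
        unfolding \<rho>_def using A(1) proj_carrier by (rule mult_smult_distrib)
      then show ?thesis
        using trace_smult[OF mult_carrier_mat[OF A(1) proj_carrier]] trace_mult_proj[OF A(1)] A(2)
        by (simp add: t_def)
    qed
    moreover have "(0::complex) \<le> 1 / of_nat ?d"
      by (simp add: less_eq_complex_def Re_divide_of_nat Im_divide_of_nat)
    ultimately show ?thesis
      unfolding wigner_def using c(1) by (auto intro!: mult_nonneg_nonneg simp del: times_divide_eq_left)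
  qed
  moreover have "mat_support ?d \<rho> \<subseteq> orth_compl ?d S"
  proof -
    \<comment> \<open>The support is the complement of the kernel, and complements reverse
      inclusion, so it suffices that \<open>S\<close> is annihilated.\<close>
    have "S \<subseteq> mat_kernel \<rho>"
    proof
      fix w assume "w \<in> S"
      moreover from this have w: "w \<in> carrier_vec ?d" by (rule S_carrier)
      ultimately have "\<rho> *\<^sub>v w = 0\<^sub>v ?d"
        using proj_eq_0_iff[OF w] S by (simp add: \<rho>_vec) (intro eq_vecI; simp)
      then show "w \<in> mat_kernel \<rho>" using w by (intro mat_kernelI[OF \<rho>])
    qed
    then show ?thesis unfolding mat_support_def orth_compl_def by blast
  qed
  ultimately show ?thesis unfolding pwf_extendible_def pwf_state_def by blast
qed

end
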